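(* Let $n\in\mathbb{N}$, let $f=(f_1,\dots,f_n)\in\mathcal{B}^n$, and let $V\subset\mathbb{R}^n$ be closed. Then there exists a Borel measurable set $G=G^1\times\cdots\times G^n\subset\mathbb{R}^n$ with $0\in G$ and with $G^k_{|\cdot|}=\{|x| : x\in G^k\}$ closed for $k=1,\dots,n$, such that $$\sup_{X\in\mathcal{T}(f)}P(X\in V)=P\big(\mathscr{S}(f,G)\in V\big).$$
   Context: $(0,1)^n$ carries Lebesgue measure on the Borel $\sigma$-algebra, which is the probability measure $P$ for random variables with domain $(0,1)^n$. A real random variable is neat if it is a monotonically increasing (nondecreasing) function $(0,1)\to\mathbb{R}$. $\mathcal{N}^n$ is the set of product random variables $X:(0,1)^n\to\mathbb{R}^n$, $X(s_1,\dots,s_n)=(X_1(s_1),\dots,X_n(s_n))$, with each $X_k$ neat (so the components are mutually independent). $\mathcal{B}$ is the set of functions $f:[0,\infty)\to[0,1]$ with $f(0)=1$, $f$ nonincreasing with limit $0$ at $\infty$, and $f$ left continuous; such $f$ is extended by $f(t)=1$ for $t<0$. For $f\in\mathcal{B}^n$, $\mathcal{T}(f)=\{X\in\mathcal{N}^n : P(|X_k|\ge t)\le f_k(t)\ \forall t\ge0,\ k=1,\dots,n\}$. For $A\subset\mathbb{R}$ write $A_{|\cdot|}=\{|x|:x\in A\}$. Let $f\in\mathcal{B}^n$ and $0\in G=G^1\times\cdots\times G^n\subset\mathbb{R}^n$ with each $G^k$ Borel measurable and each $G^k_{|\cdot|}$ closed. The absolute shift operator returns $\mathscr{S}(f,G)=(X_1,\dots,X_n):(0,1)^n\to\mathbb{R}^n$,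 the product random variable $(s_1,\dots,s_n)\mapsto(X_1(s_1),\dots,X_n(s_n))$, where, with $\widetilde{X}_k(s)=\sup f_k^{-1}[1-s,1]$ and $r_k(s)=\sup\{u\in G^k_{|\cdot|}\cup(-\infty,\inf G^k_{|\cdot|}] : u\le\widetilde{X}_k(s)\}$, $$X_k(s)=\begin{cases} r_k(s), & \text{if } r_k(s)\in G^k\cap[0,\infty),\\ -r_k(s), & \text{otherwise,}\end{cases}\qquad s\in(0,1).$$ *)

theory Defs
  imports "HOL-Probability.Probability"
begin

text \<open>
  A finite index type \<^typ>\<open>'n\<close> plays the role of \<open>{1, ..., n}\<close>. Random variables on the open
  cube \<open>(0,1)^n\<close> are total functions on \<^typ>\<open>real ^ 'n\<close>; their values off the cube never matter.
\<close>

definition cube_measure :: "(real ^ 'n) measure" where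
  "cube_measure = restrict_space lborel (box 0 1)"

lemma prob_space_cube_measure: "prob_space (cube_measure :: (real ^ 'n) measure)"
proof
  have "(\<Prod>b\<in>Basis. ((1 :: real ^ 'n) - 0) \<bullet> b) = 1"
    by (intro prod.neutral) (auto simp: Basis_vec_def inner_axis)
  then have "emeasure lborel (box 0 1 :: (real ^ 'n) set) = 1"
    by (subst emeasure_lborel_box) (auto simp: Basis_vec_def inner_axis)
  then show "emeasure cube_measure (space (cube_measure :: (real ^ 'n) measure)) = 1"
    by (simp add: cube_measure_def space_restrict_space emeasure_restrict_space)
qed

definition product_rv :: "('n \<Rightarrow> real \<Rightarrow> real) \<Rightarrow> real ^ 'n \<Rightarrow> real ^ 'n" where
  "product_rv X s = (\<chi> k. X k (s $ k))"

definition neat :: "(real \<Rightarrow> real) \<Rightarrow> bool" where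
  "neat X \<longleftrightarrow> mono_on {0<..<1} X"

definition neat_products :: "(real ^ 'n \<Rightarrow> real ^ 'n) set" where
  "neat_products = {product_rv X | X. \<forall>k. neat (X k)}"

text \<open>
  The functions \<open>[0,\<infinity>) \<rightarrow> [0,1]\<close> are represented by their extensions to the real line with
  value 1 on the negative half-line. Left continuity at 0 is automatic.
\<close>

definition tail_bounds :: "(real \<Rightarrow> real) set" where
  "tail_bounds = {f. (\<forall>t<0. f t = 1) \<and> f 0 = 1 \<and> (\<forall>t\<ge>0. f t \<in> {0..1}) \<and>
     antimono_on {0..} f \<and> (f \<longlongrightarrow> 0) at_top \<and> (\<forall>t>0. continuous (at_left t) f)}"

definition tail_bounded_rvs :: "('n \<Rightarrow> real \<Rightarrow> real) \<Rightarrow> (real ^ 'n \<Rightarrow> real ^ 'n) set" where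
  "tail_bounded_rvs f = {X \<in> neat_products.
     \<forall>k. \<forall>t\<ge>0. \<P>(s in cube_measure. \<bar>X s $ k\<bar> \<ge> t) \<le> f k t}"

definition product_set :: "('n \<Rightarrow> real set) \<Rightarrow> (real ^ 'n) set" where
  "product_set G = {x. \<forall>k. x $ k \<in> G k}"

definition tail_quantile :: "(real \<Rightarrow> real) \<Rightarrow> real \<Rightarrow> real" where
  "tail_quantile f s = Sup (f -` {1 - s..1})"

definition shift_radius :: "(real \<Rightarrow> real) \<Rightarrow> real set \<Rightarrow> real \<Rightarrow> real" where
  "shift_radius f G s = Sup {u \<in> abs ` G \<union> {..Inf (abs ` G)}. u \<le> tail_quantile f s}"

definition abs_shift_component :: "(real \<Rightarrow> real) \<Rightarrow> real set \<Rightarrow> real \<Rightarrow> real" where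
  "abs_shift_component f G s =
     (if shift_radius f G s \<in> G \<inter> {0..} then shift_radius f G s else - shift_radius f G s)"

definition abs_shift :: "('n \<Rightarrow> real \<Rightarrow> real) \<Rightarrow> ('n \<Rightarrow> real set) \<Rightarrow> real ^ 'n \<Rightarrow> real ^ 'n" where
  "abs_shift f G = product_rv (\<lambda>k. abs_shift_component (f k) (G k))"

end

theory Submission
  imports Defs
begin

text \<open>
  By Helly selection and upper semicontinuity of the probability of hitting a closed set, the
  supremum is attained at some \<open>Y\<close>. The coordinates of \<open>Y\<close> are then replaced one at a time. With all
  other coordinates fixed, the hitting probability is the expectation of \<open>g(Y\<^sub>k)\<close> for an upper
  semicontinuous \<open>g\<close>, and it is at most the expectation of the maximum of \<open>g\<close> over
  \<open>[-Q, Q]\<close>, where \<open>Q\<close> is the tail quantile function. That maximum is attained at the shift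
  into the record set of \<open>g\<close>, i.e. the set of all \<open>x\<close> that maximise \<open>g\<close> over \<open>[-|x|, |x|]\<close>.
  Conversely, each shifted coordinate has the law of a neat random variable, its quantile
  function, which satisfies the tail bound, so that the shift does not exceed the supremum.
\<close>

section \<open>Coordinates of the unit cube\<close>

abbreviation unif :: "real measure" where
  "unif \<equiv> restrict_space lborel {0<..<1}"

lemma prob_space_unif: "prob_space unif"
  by (auto simp: space_restrict_space emeasure_restrict_space intro!: prob_spaceI)

lemma measurable_vec_lambda [measurable (raw)]:
  assumes "\<And>k. (\<lambda>x. f x k) \<in> borel_measurable M"
  shows "(\<lambda>x. (\<chi> k. f x k) :: real ^ 'n) \<in> borel_measurable M"
proof -
  have "(\<lambda>x. (\<Sum>k\<in>UNIV. f x k *\<^sub>R (axis k 1 :: real ^ 'n))) \<in> borel_measurable M"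
    using assms by measurable
  moreover have "(\<Sum>k\<in>UNIV. f x k *\<^sub>R (axis k 1 :: real ^ 'n)) = (\<chi> k. f x k)" for x
    by (simp add: vec_eq_iff axis_def if_distrib cong: if_cong)
  ultimately show ?thesis by simp
qed

lemma measurable_vec_nth_real [measurable]: "(\<lambda>x :: real ^ 'n. x $ k) \<in> borel_measurable borel"
  by (intro borel_measurable_continuous_onI continuous_on_component continuous_on_id)

lemma sets_cube_measure: "sets cube_measure = sets (restrict_space borel (box 0 1))"
  unfolding cube_measure_def by (intro sets_restrict_space_cong) simp

lemma space_cube_measure: "space (cube_measure :: (real ^ 'n) measure) = box 0 1"
  by (simp add: cube_measure_def space_restrict_space)

lemma mem_unit_cube_iff: "x \<in> box (0 :: real ^ 'n) 1 \<longleftrightarrow> (\<forall>k. x $ k \<in> {0<..<1})"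
  by (simp add: mem_box_cart)

lemma measurable_cube_component: "(\<lambda>s :: real ^ 'n. s $ k) \<in> measurable cube_measure unif"
proof (rule measurable_restrict_space2)
  show "(\<lambda>s. s $ k) \<in> space cube_measure \<rightarrow> {0<..<1}"
    by (auto simp: space_cube_measure mem_unit_cube_iff)
  have "(\<lambda>s :: real ^ 'n. s $ k) \<in> borel_measurable (restrict_space borel (box 0 1))"
    by (intro measurable_restrict_space1 measurable_vec_nth_real)
  then show "(\<lambda>s :: real ^ 'n. s $ k) \<in> measurable cube_measure lborel"
    by (simp cong: measurable_cong_sets add: sets_cube_measure)
qed

text \<open>Lebesgue measure is determined by box volumes, and the preimage of a box is a product of
  intervals. Makes Fubini's theorem for finite products available on
  \<open>real ^ 'n\<close>.\<close>

lemma lborel_vec_eq: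
  "(lborel :: (real ^ 'n) measure) = distr (PiM UNIV (\<lambda>_. lborel)) borel (\<lambda>\<omega>. \<chi> k. \<omega> k)"
proof (rule lborel_eqI)
  interpret product_sigma_finite "\<lambda>_ :: 'n. lborel :: real measure"
    by standard
  have [measurable]: "(\<lambda>\<omega>. \<chi> k. \<omega> k) \<in> borel_measurable (PiM UNIV (\<lambda>_ :: 'n. lborel :: real measure))"
    by measurable
  fix l u :: "real ^ 'n"
  assume *: "\<And>b. b \<in> Basis \<Longrightarrow> l \<bullet> b \<le> u \<bullet> b"
  have le: "l $ k \<le> u $ k" for k
    using *[of "axis k 1"] by (simp add: axis_in_Basis_iff inner_axis)
  have "(\<lambda>\<omega>. \<chi> k. \<omega> k) -` box l u \<inter> space (PiM UNIV (\<lambda>_ :: 'n. lborel :: real measure))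
      = (\<Pi>\<^sub>E k\<in>UNIV. {l $ k<..<u $ k})"
    by (auto simp: mem_box_cart space_PiM PiE_iff)
  then have "emeasure (distr (PiM UNIV (\<lambda>_. lborel)) borel (\<lambda>\<omega>. \<chi> k. \<omega> k)) (box l u)
      = (\<Prod>k\<in>UNIV. emeasure lborel {l $ k<..<u $ k})"
    by (simp add: emeasure_distr emeasure_PiM)
  also have "\<dots> = ennreal (\<Prod>k\<in>UNIV. u $ k - l $ k)"
    using le by (simp add: prod_ennreal)
  also have "(\<Prod>k\<in>UNIV. u $ k - l $ k) = (\<Prod>b\<in>Basis. (u - l) \<bullet> b)"
  proof -
    have Basis: "(Basis :: (real ^ 'n) set) = range (\<lambda>k. axis k 1)"
      by (auto simp: Basis_vec_def)
    have inj: "inj (\<lambda>k :: 'n. axis k (1 :: real))"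
      by (auto simp: inj_on_def axis_eq_axis)
    show ?thesis
      unfolding Basis prod.reindex[OF inj] by (simp add: inner_axis)
  qed
  finally show "emeasure (distr (PiM UNIV (\<lambda>_. lborel)) borel (\<lambda>\<omega>. \<chi> k. \<omega> k)) (box l u)
      = (\<Prod>b\<in>Basis. (u - l) \<bullet> b)" .
qed simp

lemma measurable_cube_PiM:
  "(\<lambda>s k. s $ k) \<in> measurable (cube_measure :: (real ^ 'n) measure) (PiM UNIV (\<lambda>_. unif))"
  using measurable_cube_component
  by (intro measurable_PiM_single')
     (auto simp: space_cube_measure mem_unit_cube_iff space_restrict_space)

text \<open>A finite product measure is determined by rectangles; a rectangle inside the cube has
  its Lebesgue measure, which factorises by \<open>lborel_vec_eq\<close>. Independence of the
  coordinates enters here.\<close>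

lemma PiM_unif_eq:
  "PiM UNIV (\<lambda>_ :: 'n::finite. unif) = distr cube_measure (PiM UNIV (\<lambda>_. unif)) (\<lambda>s k. s $ k)"
proof (rule product_sigma_finite.PiM_eqI[symmetric])
  interpret L: product_sigma_finite "\<lambda>_ :: 'n. lborel :: real measure"
    by standard
  interpret P: product_prob_space "\<lambda>_ :: 'n. unif" UNIV
    by (intro product_prob_spaceI prob_space_unif)
  show "product_sigma_finite (\<lambda>_ :: 'n. unif)" by unfold_locales
  fix A :: "'n \<Rightarrow> real set"
  assume A: "\<And>k. k \<in> UNIV \<Longrightarrow> A k \<in> sets unif"
  have sub: "A k \<subseteq> {0<..<1}" and bor [measurable]: "A k \<in> sets borel" for k
    using A[of k] by (auto simp: sets_restrict_space)
  have mB: "{s :: real ^ 'n. \<forall>k. s $ k \<in> A k} \<in> sets borel"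
    by measurable
  have subB: "{s :: real ^ 'n. \<forall>k. s $ k \<in> A k} \<subseteq> box 0 1"
    using sub by (fastforce simp: mem_unit_cube_iff)
  have meas: "(\<lambda>\<omega>. \<chi> k. \<omega> k) \<in> borel_measurable (PiM UNIV (\<lambda>_ :: 'n. lborel :: real measure))"
    by measurable
  have "emeasure (distr cube_measure (PiM UNIV (\<lambda>_. unif)) (\<lambda>s k. s $ k)) (PiE UNIV A)
      = emeasure cube_measure {s :: real ^ 'n. \<forall>k. s $ k \<in> A k}"
    using A subB measurable_cube_PiM
    by (subst emeasure_distr)
       (auto intro!: sets_PiM_I_finite arg_cong2[where f=emeasure] simp: space_cube_measure PiE_iff)
  also have "\<dots> = emeasure lborel {s :: real ^ 'n. \<forall>k. s $ k \<in> A k}"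
    using subB mB by (simp add: cube_measure_def emeasure_restrict_space)
  also have "\<dots> = emeasure (PiM UNIV (\<lambda>_. lborel)) (PiE UNIV A)"
    unfolding lborel_vec_eq using mB meas
    by (subst emeasure_distr) (auto intro!: arg_cong2[where f=emeasure] simp: space_PiM PiE_iff)
  also have "\<dots> = (\<Prod>k\<in>UNIV. emeasure lborel (A k))"
    by (subst L.emeasure_PiM) auto
  also have "\<dots> = (\<Prod>k\<in>UNIV. emeasure unif (A k))"
    using sub by (simp add: emeasure_restrict_space)
  finally show "emeasure (distr cube_measure (PiM UNIV (\<lambda>_. unif)) (\<lambda>s k. s $ k)) (PiE UNIV A)
      = (\<Prod>k\<in>UNIV. emeasure unif (A k))" .
qed auto

text \<open>Fubini's theorem with coordinate \<open>k\<close> outermost. The inner integral still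
  runs over the whole cube, which avoids a cube of lower dimension: its integrand ignores
  \<open>s $ k\<close>, and that coordinate carries total mass 1.\<close>

lemma nn_integral_cube_resample:
  fixes F :: "real ^ 'n \<Rightarrow> ennreal"
  assumes F: "F \<in> borel_measurable cube_measure"
  shows "(\<integral>\<^sup>+ s. F s \<partial>cube_measure)
    = (\<integral>\<^sup>+ x. (\<integral>\<^sup>+ s. F (\<chi> j. if j = k then x else s $ j) \<partial>cube_measure) \<partial>unif)"
proof -
  interpret P: product_prob_space "\<lambda>_ :: 'n. unif" UNIV
    by (intro product_prob_spaceI prob_space_unif)
  let ?P = "PiM UNIV (\<lambda>_ :: 'n. unif)" and ?Q = "PiM (UNIV - {k}) (\<lambda>_ :: 'n. unif)"
  define F' where "F' \<omega> = F (\<chi> k. \<omega> k)" for \<omega> :: "'n \<Rightarrow> real"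
  have vec: "(\<lambda>\<omega>. \<chi> k. \<omega> k) \<in> measurable ?P (cube_measure :: (real ^ 'n) measure)"
    unfolding cube_measure_def
  proof (rule measurable_restrict_space2)
    show "(\<lambda>\<omega>. \<chi> k. \<omega> k) \<in> space ?P \<rightarrow> box (0 :: real ^ 'n) 1"
      by (auto simp: space_PiM mem_unit_cube_iff PiE_iff space_restrict_space)
    have "(\<lambda>\<omega>. \<omega> k) \<in> borel_measurable ?P" for k
      by (rule measurable_compose[OF measurable_component_singleton[of k UNIV "\<lambda>_. unif"]])
         (auto intro: measurable_restrict_space1)
    then have "(\<lambda>\<omega>. \<chi> k. \<omega> k) \<in> borel_measurable ?P"
      by (intro measurable_vec_lambda)
    then show "(\<lambda>\<omega>. \<chi> k. \<omega> k) \<in> measurable ?P (lborel :: (real ^ 'n) measure)"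
      by simp
  qed
  have F' [measurable]: "F' \<in> borel_measurable ?P"
    unfolding F'_def using measurable_compose[OF vec F] by simp
  have split: "(\<integral>\<^sup>+ \<omega>. H \<omega> \<partial>?P) = (\<integral>\<^sup>+ y. (\<integral>\<^sup>+ x. H (x(k := y)) \<partial>?Q) \<partial>unif)"
    if "H \<in> borel_measurable ?P" for H
    using P.product_nn_integral_insert_rev[of "UNIV - {k}" k H] that
    by (simp add: insert_absorb)
  have to_cube: "(\<integral>\<^sup>+ \<omega>. H \<omega> \<partial>?P) = (\<integral>\<^sup>+ s. H (\<lambda>k. s $ k) \<partial>cube_measure)"
    if "H \<in> borel_measurable ?P" for H
    by (subst PiM_unif_eq, subst nn_integral_distr[OF measurable_cube_PiM]) (simp_all add: that)
  have upd: "(\<lambda>x. F' (x(k := y))) \<in> borel_measurable ?P" if "y \<in> space unif" for y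
    using that by (intro measurable_compose[OF _ F'])
      (rule measurable_fun_upd[where I = UNIV and J = UNIV], auto)
  have "(\<integral>\<^sup>+ s. F s \<partial>cube_measure) = (\<integral>\<^sup>+ \<omega>. F' \<omega> \<partial>?P)"
    by (subst to_cube) (auto simp: F'_def)
  also have "\<dots> = (\<integral>\<^sup>+ y. (\<integral>\<^sup>+ x. F' (x(k := y)) \<partial>?Q) \<partial>unif)"
    by (rule split) simp
  also have "\<dots> = (\<integral>\<^sup>+ y. (\<integral>\<^sup>+ x. F' (x(k := y)) \<partial>?P) \<partial>unif)"
  proof (rule nn_integral_cong)
    fix y assume "y \<in> space unif"
    then show "(\<integral>\<^sup>+ x. F' (x(k := y)) \<partial>?Q) = (\<integral>\<^sup>+ x. F' (x(k := y)) \<partial>?P)"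
      using prob_space.emeasure_space_1[OF prob_space_unif]
      by (subst split[OF upd]) simp_all
  qed
  also have "\<dots> = (\<integral>\<^sup>+ y. (\<integral>\<^sup>+ s. F (\<chi> j. if j = k then y else s $ j) \<partial>cube_measure) \<partial>unif)"
    by (intro nn_integral_cong, subst to_cube[OF upd])
       (auto simp: F'_def fun_upd_def intro!: nn_integral_cong)
  finally show ?thesis .
qed

section \<open>Record sets and shifts\<close>

text \<open>Without a maximiser the open sets \<open>{x. g x < g y}\<close> with \<open>y\<close> in
  \<open>K\<close> would cover \<open>K\<close>; in a finite subcover the index \<open>y\<close>
  with the largest value would itself have to lie below a larger one.\<close>

lemma compact_attains_sup_usc:
  fixes g :: "'a::topological_space \<Rightarrow> 'b::linorder"
  assumes usc: "\<And>c. closed {x. c \<le> g x}" and "compact K" "K \<noteq> {}"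
  shows "\<exists>x\<in>K. \<forall>y\<in>K. g y \<le> g x"
proof (rule ccontr)
  assume "\<not> ?thesis"
  then have cover: "K \<subseteq> (\<Union>y\<in>K. {x. g x < g y})"
    by (auto simp: not_le)
  have op: "open {x. g x < g y}" for y
  proof -
    have "{x. g x < g y} = - {x. g y \<le> g x}" by (simp add: Compl_eq not_le)
    then show ?thesis using usc[of "g y"] by (simp add: open_Compl)
  qed
  obtain D where D: "D \<subseteq> K" "finite D" "K \<subseteq> (\<Union>y\<in>D. {x. g x < g y})"
    by (rule compactE_image[OF \<open>compact K\<close> op cover])
  have "D \<noteq> {}" using D(3) \<open>K \<noteq> {}\<close> by auto
  then have "Max (g ` D) \<in> g ` D" using D(2) by simp
  then obtain y where y: "y \<in> D" "Max (g ` D) = g y" by (rule imageE)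
  from y(1) D obtain z where z: "z \<in> D" "g y < g z" by fastforce
  moreover have "g z \<le> Max (g ` D)" using z(1) D(2) by simp
  ultimately show False using y(2) by simp
qed

definition record_set :: "(real \<Rightarrow> 'b::linorder) \<Rightarrow> real set" where
  "record_set g = {x. \<forall>y. \<bar>y\<bar> \<le> \<bar>x\<bar> \<longrightarrow> g y \<le> g x}"

lemma zero_in_record_set: "0 \<in> record_set g"
  by (simp add: record_set_def)

text \<open>A maximiser \<open>x\<close> over \<open>[-r, r]\<close> also maximises over the smaller
  interval \<open>[-|x|, |x|]\<close>, hence is a record.\<close>

lemma record_set_attains:
  assumes "\<And>c. closed {x. c \<le> g x}" and "0 \<le> r"
  shows "\<exists>x\<in>record_set g. \<bar>x\<bar> \<le> r \<and> (\<forall>y. \<bar>y\<bar> \<le> r \<longrightarrow> g y \<le> g x)"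
proof -
  have "{- r..r} \<noteq> {}" using assms(2) by simp
  then obtain x where "x \<in> {- r..r}" "\<forall>y\<in>{- r..r}. g y \<le> g x"
    using compact_attains_sup_usc[OF assms(1) compact_Icc, of "- r" r] by blast
  then have x: "\<bar>x\<bar> \<le> r" "\<forall>y. \<bar>y\<bar> \<le> r \<longrightarrow> g y \<le> g x" by (auto simp: abs_le_iff)
  moreover from x have "x \<in> record_set g"
    unfolding record_set_def by (blast intro: order_trans)
  ultimately show ?thesis by blast
qed

text \<open>
  In the limit of record points, either a maximiser over the limiting interval lies on its
  boundary, or it lies strictly inside and is eventually dominated by the approximating records.
\<close>

lemma closed_abs_record_set:
  assumes usc: "\<And>c. closed {x. c \<le> g x}"
  shows "closed (abs ` record_set g)"
  unfolding closed_sequential_limits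
proof (intro allI impI, elim conjE)
  fix r l assume "\<forall>n. r n \<in> abs ` record_set g" and lim: "r \<longlonglongrightarrow> l"
  then have "\<forall>n. \<exists>x. x \<in> record_set g \<and> \<bar>x\<bar> = r n" by (metis imageE)
  then obtain x where x: "\<And>n. x n \<in> record_set g" "\<And>n. \<bar>x n\<bar> = r n" by metis
  \<comment> \<open>Only the moduli are known to converge; the signs may alternate, so a subsequence
    is taken.\<close>
  have "bounded (range x)"
    using convergent_imp_bounded[OF lim] by (simp add: bounded_iff x(2)[symmetric])
  then obtain z \<sigma> where \<sigma>: "strict_mono (\<sigma> :: nat \<Rightarrow> nat)" "(x \<circ> \<sigma>) \<longlonglongrightarrow> z"
    using bounded_imp_convergent_subsequence by blast
  have r\<sigma>: "(\<lambda>n. \<bar>x (\<sigma> n)\<bar>) \<longlonglongrightarrow> l"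
    using LIMSEQ_subseq_LIMSEQ[OF lim \<sigma>(1)] x(2) by (simp add: o_def)
  moreover have "(\<lambda>n. \<bar>x (\<sigma> n)\<bar>) \<longlonglongrightarrow> \<bar>z\<bar>"
    using \<sigma>(2) by (intro tendsto_rabs) (simp add: o_def)
  ultimately have z: "\<bar>z\<bar> = l" by (rule LIMSEQ_unique[symmetric])
  then obtain y where y: "y \<in> record_set g" "\<bar>y\<bar> \<le> l" "\<And>u. \<bar>u\<bar> \<le> l \<Longrightarrow> g u \<le> g y"
    using record_set_attains[OF usc, of l] abs_ge_zero by metis
  show "l \<in> abs ` record_set g"
  proof (cases "\<bar>y\<bar> = l")
    \<comment> \<open>Here \<open>y\<close> may be \<open>- z\<close>, with \<open>z\<close> itself
      not a record: only the modulus matters.\<close>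
    case True
    then show ?thesis using y(1) by blast
  next
    case False
    then have "\<forall>\<^sub>F n in sequentially. \<bar>y\<bar> < \<bar>x (\<sigma> n)\<bar>"
      using y(2) by (intro order_tendstoD(1)[OF r\<sigma>]) simp
    then have "\<forall>\<^sub>F n in sequentially. (x \<circ> \<sigma>) n \<in> {u. g y \<le> g u}"
    proof eventually_elim
      case (elim n)
      then show ?case using x(1)[of "\<sigma> n"] by (simp add: record_set_def)
    qed
    then have "g y \<le> g z"
      using Lim_in_closed_set[OF usc _ _ \<sigma>(2)] by auto
    then have "z \<in> record_set g"
      unfolding record_set_def using y(3) z by (blast intro: order_trans)
    then show ?thesis using z by blast
  qed
qed

text \<open>A point \<open>x\<close> fails to be a record iff some rational \<open>q\<close>
  separates \<open>g x\<close> from a larger value attained within radius \<open>|x|\<close>. For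
  fixed \<open>q\<close> the latter is a lower bound on \<open>|x|\<close>, since a nonempty closed
  superlevel set has a point of least modulus.\<close>

lemma sets_record_set:
  fixes g :: "real \<Rightarrow> real"
  assumes usc: "\<And>c. closed {x. c \<le> g x}"
  shows "record_set g \<in> sets borel"
proof -
  have lt: "{x. g x < q} \<in> sets borel" for q
    using borel_closed[OF usc[of q]] sets.compl_sets[of "{x. q \<le> g x}" borel]
    by (simp add: Compl_eq_Diff_UNIV[symmetric] Compl_eq not_le)
  have ge: "{x. \<exists>y. q \<le> g y \<and> \<bar>y\<bar> \<le> \<bar>x\<bar>} \<in> sets borel" for q
  proof (cases "{x. q \<le> g x} = {}")
    case False
    then obtain t where t: "q \<le> g t" "\<And>y. q \<le> g y \<Longrightarrow> \<bar>t\<bar> \<le> \<bar>y\<bar>"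
      using distance_attains_inf[OF usc, of q 0] by (auto simp: dist_real_def)
    have "{x. \<exists>y. q \<le> g y \<and> \<bar>y\<bar> \<le> \<bar>x\<bar>} = {x. \<bar>t\<bar> \<le> \<bar>x\<bar>}"
      using t by (auto intro: order_trans)
    then show ?thesis by simp
  qed auto
  have "- record_set g = (\<Union>q\<in>\<rat>. {x. g x < q} \<inter> {x. \<exists>y. q \<le> g y \<and> \<bar>y\<bar> \<le> \<bar>x\<bar>})"
  proof (intro equalityI subsetI)
    fix x assume "x \<in> - record_set g"
    then obtain y where y: "\<bar>y\<bar> \<le> \<bar>x\<bar>" "g x < g y" by (auto simp: record_set_def not_le)
    then obtain q where "q \<in> \<rat>" "g x < q" "q < g y" using Rats_dense_in_real by blast
    then show "x \<in> (\<Union>q\<in>\<rat>. {x. g x < q} \<inter> {x. \<exists>y. q \<le> g y \<and> \<bar>y\<bar> \<le> \<bar>x\<bar>})"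
      using y by force
  next
    fix x assume "x \<in> (\<Union>q\<in>\<rat>. {x. g x < q} \<inter> {x. \<exists>y. q \<le> g y \<and> \<bar>y\<bar> \<le> \<bar>x\<bar>})"
    then show "x \<in> - record_set g" by (force simp: record_set_def)
  qed
  also have "\<dots> \<in> sets borel"
    using lt ge by (intro sets.countable_UN' countable_rat) auto
  finally show ?thesis
    using sets.compl_sets[of "- record_set g" borel] by (simp add: Compl_eq_Diff_UNIV[symmetric])
qed

section \<open>Quantile functions of tail bounds, and the shift of one coordinate\<close>

lemma tail_bounds_le_1: "f \<in> tail_bounds \<Longrightarrow> f t \<le> 1"
  by (cases "t < 0") (auto simp: tail_bounds_def)

lemma tail_bounds_nonneg: "f \<in> tail_bounds \<Longrightarrow> 0 \<le> f t"
  by (cases "t < 0") (auto simp: tail_bounds_def)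

lemma tail_bounds_antimono:
  assumes f: "f \<in> tail_bounds" and "a \<le> b"
  shows "f b \<le> f a"
proof (cases "a < 0")
  case True
  then have "f a = 1" using f by (simp add: tail_bounds_def)
  then show ?thesis using tail_bounds_le_1[OF f] by simp
next
  case False
  moreover have "antimono_on {0..} f" using f by (simp add: tail_bounds_def)
  ultimately show ?thesis using \<open>a \<le> b\<close> by (simp add: monotone_on_def)
qed

text \<open>For \<open>s < 1\<close> the level \<open>1 - s\<close> is positive while
  \<open>f\<close> tends to 0. The \<open>Sup\<close> in \<open>tail_quantile\<close> is meaningful
  only because of this bound.\<close>

lemma bdd_above_tail_vimage:
  assumes f: "f \<in> tail_bounds" and s: "s < 1"
  shows "bdd_above (f -` {1 - s..1})"
proof -
  have "\<forall>\<^sub>F t in at_top. f t < 1 - s"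
    using f s by (intro order_tendstoD(2)[of f 0]) (auto simp: tail_bounds_def)
  then obtain B where B: "\<And>t. t \<ge> B \<Longrightarrow> f t < 1 - s" by (auto simp: eventually_at_top_linorder)
  show ?thesis
  proof (rule bdd_aboveI[of _ B])
    fix x assume "x \<in> f -` {1 - s..1}"
    then show "x \<le> B" using B[of x] by (cases "x \<le> B") auto
  qed
qed

text \<open>The Galois connection behind the later facts about quantiles. Left continuity gives the
  forward direction: if \<open>f t < 1 - s\<close>, then \<open>f\<close> is below
  \<open>1 - s\<close> already at some \<open>m < t\<close>, and \<open>m\<close> bounds the
  supremum.\<close>

lemma tail_quantile_ge_iff:
  assumes f: "f \<in> tail_bounds" and s: "s \<in> {0<..<1}" and t: "0 \<le> t"
  shows "t \<le> tail_quantile f s \<longleftrightarrow> 1 - s \<le> f t"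
proof
  assume "1 - s \<le> f t"
  then show "t \<le> tail_quantile f s"
    unfolding tail_quantile_def using s tail_bounds_le_1[OF f]
    by (intro cSup_upper bdd_above_tail_vimage[OF f]) auto
next
  assume ge: "t \<le> tail_quantile f s"
  show "1 - s \<le> f t"
  proof (rule ccontr)
    assume *: "\<not> 1 - s \<le> f t"
    have "f 0 = 1" using f by (simp add: tail_bounds_def)
    with * s have "t \<noteq> 0" by auto
    with t have "0 < t" by simp
    then have "(f \<longlongrightarrow> f t) (at_left t)"
      using f by (auto simp: tail_bounds_def continuous_within)
    then have "\<forall>\<^sub>F u in at_left t. f u < 1 - s"
      using * by (intro order_tendstoD(2)) auto
    then obtain b where b: "b < t" "\<And>u. b < u \<Longrightarrow> u < t \<Longrightarrow> f u < 1 - s"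
      unfolding eventually_at_left[OF \<open>0 < t\<close>] by auto
    define m where "m = (b + t) / 2"
    have m: "m < t" "f m < 1 - s" using b by (auto simp: m_def)
    have "tail_quantile f s \<le> m"
      unfolding tail_quantile_def
    proof (rule cSup_least)
      have "0 \<in> f -` {1 - s..1}" using \<open>f 0 = 1\<close> s by simp
      then show "f -` {1 - s..1} \<noteq> {}" by blast
      fix u assume u: "u \<in> f -` {1 - s..1}"
      show "u \<le> m"
        using tail_bounds_antimono[OF f, of m u] u m by (cases "u \<le> m") auto
    qed
    with ge m show False by simp
  qed
qed

lemma tail_quantile_nonneg:
  assumes "f \<in> tail_bounds" "s \<in> {0<..<1}"
  shows "0 \<le> tail_quantile f s"
  using assms tail_quantile_ge_iff[OF assms, of 0] by (auto simp: tail_bounds_def)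

lemma mono_on_tail_quantile:
  assumes f: "f \<in> tail_bounds"
  shows "mono_on {0<..<1} (tail_quantile f)"
proof (rule mono_onI)
  fix s u :: real assume s: "s \<in> {0<..<1}" and u: "u \<in> {0<..<1}" and "s \<le> u"
  note 0 = tail_quantile_nonneg[OF f s]
  show "tail_quantile f s \<le> tail_quantile f u"
    using tail_quantile_ge_iff[OF f s 0] tail_quantile_ge_iff[OF f u 0] \<open>s \<le> u\<close> by auto
qed

text \<open>The event is \<open>s >= 1 - f t\<close>. So the bound \<open>f\<close> is met with
  equality: no variable with tails bounded by \<open>f\<close> has a stochastically larger modulus
  than the quantile function.\<close>

lemma measure_tail_quantile_ge:
  assumes f: "f \<in> tail_bounds" and t: "0 \<le> t"
  shows "measure unif {s \<in> {0<..<1}. t \<le> tail_quantile f s} = f t"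
proof -
  have "{s \<in> {0<..<1}. t \<le> tail_quantile f s} = {0<..<1} \<inter> {1 - f t..}"
    using tail_quantile_ge_iff[OF f _ t] by auto
  then have "measure unif {s \<in> {0<..<1}. t \<le> tail_quantile f s} = measure unif ({0<..<1} \<inter> {1 - f t..})"
    by simp
  also have "\<dots> = measure lborel ({0<..<1} \<inter> {1 - f t..})"
    by (subst measure_restrict_space) auto
  also have "\<dots> = measure lborel {1 - f t..1}"
    unfolding measure_def
  proof (intro arg_cong[where f=enn2real] emeasure_eq_AE)
    \<comment> \<open>The two sets differ at most in the points 0 and 1, as
      \<open>0 <= 1 - f t\<close>.\<close>
    show "AE x in lborel. x \<in> {0<..<1} \<inter> {1 - f t..} \<longleftrightarrow> x \<in> {1 - f t..1}"
      using AE_lborel_singleton[of "0::real"] AE_lborel_singleton[of "1::real"]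
      by eventually_elim (use tail_bounds_le_1[OF f, of t] in auto)
  qed auto
  also have "\<dots> = f t"
    using tail_bounds_nonneg[OF f] by simp
  finally show ?thesis .
qed

text \<open>As 0 lies in \<open>G\<close>, the infimum of the moduli is 0 and the half-line
  contributes only numbers \<open><= 0\<close>. The set under the supremum is closed, so the
  supremum is attained: the radius is the largest modulus of points of \<open>G\<close> not
  exceeding the quantile.\<close>

lemma shift_radius_props:
  assumes f: "f \<in> tail_bounds" and s: "s \<in> {0<..<1}" and G: "0 \<in> G" "closed (abs ` G)"
  shows "shift_radius f G s \<in> abs ` G" "shift_radius f G s \<le> tail_quantile f s"
    "\<And>u. u \<in> abs ` G \<Longrightarrow> u \<le> tail_quantile f s \<Longrightarrow> u \<le> shift_radius f G s"
proof -
  let ?A = "{u \<in> abs ` G \<union> {..Inf (abs ` G)}. u \<le> tail_quantile f s}"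
  have "?A = (abs ` G \<union> {..Inf (abs ` G)}) \<inter> {..tail_quantile f s}" by auto
  then have cl: "closed ?A" using G by (simp only: closed_Int closed_Un closed_atMost)
  have 0: "0 \<in> ?A" using G tail_quantile_nonneg[OF f s] by (auto intro!: image_eqI[of _ _ 0])
  have bdd: "bdd_above ?A" by (intro bdd_aboveI[of _ "tail_quantile f s"]) auto
  have mem: "shift_radius f G s \<in> ?A"
    unfolding shift_radius_def using 0 bdd cl by (intro closed_contains_Sup) auto
  show upper: "u \<le> shift_radius f G s" if "u \<in> abs ` G" "u \<le> tail_quantile f s" for u
    unfolding shift_radius_def using that bdd by (intro cSup_upper) auto
  have ge0: "0 \<le> shift_radius f G s"
    unfolding shift_radius_def using 0 bdd by (intro cSup_upper) auto
  have "Inf (abs ` G) = 0"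
    using G by (intro cInf_eq_minimum) (auto intro!: image_eqI[of _ _ 0])
  then show "shift_radius f G s \<in> abs ` G"
    using mem ge0 G by (cases "shift_radius f G s = 0") (auto intro: image_eqI[of _ _ 0])
  show "shift_radius f G s \<le> tail_quantile f s" using mem by simp
qed

lemma abs_shift_component_props:
  assumes f: "f \<in> tail_bounds" and s: "s \<in> {0<..<1}" and G: "0 \<in> G" "closed (abs ` G)"
  shows "abs_shift_component f G s \<in> G" "\<bar>abs_shift_component f G s\<bar> = shift_radius f G s"
  using shift_radius_props(1)[OF assms]
  by (auto simp: abs_shift_component_def abs_real_def split: if_splits)

text \<open>The radius inherits monotonicity from the quantile. The component itself need not be
  monotone, because its sign depends on membership in \<open>G\<close>; measurability is what
  survives.\<close>

lemma measurable_abs_shift_component: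
  assumes f: "f \<in> tail_bounds" and G: "0 \<in> G" "closed (abs ` G)" and [measurable]: "G \<in> sets borel"
  shows "abs_shift_component f G \<in> borel_measurable unif"
proof -
  have "mono_on {0<..<1} (shift_radius f G)"
  proof (rule mono_onI)
    fix s u :: real assume s: "s \<in> {0<..<1}" and u: "u \<in> {0<..<1}" and "s \<le> u"
    then have "shift_radius f G s \<le> tail_quantile f u"
      using shift_radius_props(2)[OF f s G] mono_onD[OF mono_on_tail_quantile[OF f] s u] by simp
    then show "shift_radius f G s \<le> shift_radius f G u"
      using shift_radius_props[OF f _ G] s u by blast
  qed
  then have [measurable]: "shift_radius f G \<in> borel_measurable unif"
    using borel_measurable_mono_on_fnc by (simp cong: measurable_cong_sets sets_restrict_space_cong)
  have "(\<lambda>s. if shift_radius f G s \<in> G \<inter> {0..} then shift_radius f G s else - shift_radius f G s)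
      \<in> borel_measurable unif"
    by measurable
  then show ?thesis by (simp add: abs_shift_component_def[abs_def])
qed

text \<open>With \<open>Q\<close> the quantile, the maximum over \<open>[-Q, Q]\<close> is attained
  at a record of modulus at most \<open>Q\<close>. The shift is a record of at least that modulus,
  so its value is at least as large.\<close>

lemma abs_shift_component_record_set:
  assumes f: "f \<in> tail_bounds" and s: "s \<in> {0<..<1}" and usc: "\<And>c. closed {x. c \<le> g x}"
    and y: "\<bar>y\<bar> \<le> tail_quantile f s"
  shows "g y \<le> g (abs_shift_component f (record_set g) s)"
proof -
  note G = zero_in_record_set closed_abs_record_set[OF usc]
  obtain x where x: "x \<in> record_set g" "\<bar>x\<bar> \<le> tail_quantile f s" "g y \<le> g x"
    using record_set_attains[OF usc tail_quantile_nonneg[OF f s]] y by blast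
  then have "\<bar>x\<bar> \<le> \<bar>abs_shift_component f (record_set g) s\<bar>"
    using shift_radius_props(3)[OF f s G, of "\<bar>x\<bar>"] abs_shift_component_props(2)[OF f s G] by simp
  then show ?thesis
    using abs_shift_component_props(1)[OF f s G] x(3) by (auto simp: record_set_def intro: order_trans)
qed

text \<open>The modulus of the shift never exceeds the quantile, whose tail is exactly
  \<open>f\<close>.\<close>

lemma measure_abs_shift_component_ge:
  assumes f: "f \<in> tail_bounds" and G: "0 \<in> G" "closed (abs ` G)" and "G \<in> sets borel" and t: "0 \<le> t"
  shows "measure unif {s \<in> {0<..<1}. t \<le> \<bar>abs_shift_component f G s\<bar>} \<le> f t"
proof -
  interpret prob_space unif by (rule prob_space_unif)
  have [measurable]: "tail_quantile f \<in> borel_measurable unif"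
    using borel_measurable_mono_on_fnc[OF mono_on_tail_quantile[OF f]]
    by (simp cong: measurable_cong_sets sets_restrict_space_cong)
  have "{s \<in> space unif. t \<le> tail_quantile f s} \<in> sets unif" by measurable
  then have "measure unif {s \<in> {0<..<1}. t \<le> \<bar>abs_shift_component f G s\<bar>}
      \<le> measure unif {s \<in> {0<..<1}. t \<le> tail_quantile f s}"
    using shift_radius_props(2)[OF f _ G] abs_shift_component_props(2)[OF f _ G]
    by (intro finite_measure_mono) (auto simp: space_restrict_space intro: order_trans)
  then show ?thesis using measure_tail_quantile_ge[OF f t] by simp
qed

text \<open>Layer cake formula: the integral of \<open>w\<close> is the integral over
  \<open>c > 0\<close> of the probability that \<open>w >= c\<close>, so domination of superlevel
  probabilities carries over to expectations.\<close>

lemma nn_integral_le_of_measure_superlevel_le: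
  fixes u v :: "'a \<Rightarrow> real"
  assumes "prob_space M" and [measurable]: "u \<in> borel_measurable M" "v \<in> borel_measurable M"
    and nonneg: "\<And>x. 0 \<le> u x" "\<And>x. 0 \<le> v x"
    and le: "\<And>c. 0 < c \<Longrightarrow> measure M {x \<in> space M. c \<le> u x} \<le> measure M {x \<in> space M. c \<le> v x}"
  shows "(\<integral>\<^sup>+ x. ennreal (u x) \<partial>M) \<le> (\<integral>\<^sup>+ x. ennreal (v x) \<partial>M)"
proof -
  interpret prob_space M by fact
  interpret pair_sigma_finite M "lborel :: real measure" by standard
  have layer: "(\<integral>\<^sup>+ x. ennreal (w x) \<partial>M)
      = (\<integral>\<^sup>+ c. indicator {0<..} c * ennreal (measure M {x \<in> space M. c \<le> w x}) \<partial>lborel)"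
    if [measurable]: "w \<in> borel_measurable M" and w: "\<And>x. 0 \<le> w x" for w :: "'a \<Rightarrow> real"
  proof -
    have [measurable]: "(\<lambda>(x, c). indicator {0<..w x} c :: ennreal) \<in> borel_measurable (M \<Otimes>\<^sub>M lborel)"
      by (simp add: indicator_def) measurable
    have "(\<integral>\<^sup>+ x. ennreal (w x) \<partial>M) = (\<integral>\<^sup>+ x. (\<integral>\<^sup>+ c. indicator {0<..w x} c \<partial>lborel) \<partial>M)"
      using w by (intro nn_integral_cong) simp
    also have "\<dots> = (\<integral>\<^sup>+ c. (\<integral>\<^sup>+ x. indicator {0<..w x} c \<partial>M) \<partial>lborel)"
      by (rule Fubini'[symmetric]) simp
    also have "\<dots> = (\<integral>\<^sup>+ c. indicator {0<..} c * ennreal (measure M {x \<in> space M. c \<le> w x}) \<partial>lborel)"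
    proof (rule nn_integral_cong)
      fix c :: real
      have "(\<integral>\<^sup>+ x. indicator {0<..w x} c \<partial>M)
          = (\<integral>\<^sup>+ x. indicator {0<..} c * indicator {x \<in> space M. c \<le> w x} x \<partial>M)"
        by (intro nn_integral_cong) (auto simp: indicator_def)
      also have "\<dots> = indicator {0<..} c * emeasure M {x \<in> space M. c \<le> w x}"
        by (subst nn_integral_cmult) auto
      finally show "(\<integral>\<^sup>+ x. indicator {0<..w x} c \<partial>M)
          = indicator {0<..} c * ennreal (measure M {x \<in> space M. c \<le> w x})"
        by (simp add: emeasure_eq_measure)
    qed
    finally show ?thesis .
  qed
  show ?thesis
    unfolding layer[OF assms(2) nonneg(1)] layer[OF assms(3) nonneg(2)]
    by (intro nn_integral_mono) (auto simp: indicator_def intro!: ennreal_leI le)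
qed

lemma borel_measurable_usc:
  fixes g :: "real \<Rightarrow> real"
  assumes "\<And>c. closed {x. c \<le> g x}"
  shows "g \<in> borel_measurable borel"
  unfolding borel_measurable_iff_ge using assms by auto

text \<open>For each attained level \<open>c\<close> let \<open>t\<close> be a point of least
  modulus with \<open>g t >= c\<close>. Then \<open>g (Z s) >= c\<close> forces
  \<open>|Z s| >= |t|\<close>, which has probability at most \<open>f |t|\<close>; the quantile
  reaches \<open>|t|\<close> with probability exactly \<open>f |t|\<close>, and there the shift
  attains level \<open>c\<close>.\<close>

lemma nn_integral_le_abs_shift_component:
  assumes f: "f \<in> tail_bounds" and usc: "\<And>c. closed {x. c \<le> g x}" and g: "\<And>x. 0 \<le> g x"
    and Z: "Z \<in> borel_measurable unif"
    and tail: "\<And>t. 0 \<le> t \<Longrightarrow> measure unif {s \<in> {0<..<1}. t \<le> \<bar>Z s\<bar>} \<le> f t"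
  shows "(\<integral>\<^sup>+ s. ennreal (g (Z s)) \<partial>unif)
    \<le> (\<integral>\<^sup>+ s. ennreal (g (abs_shift_component f (record_set g) s)) \<partial>unif)"
proof (rule nn_integral_le_of_measure_superlevel_le[OF prob_space_unif])
  interpret prob_space unif by (rule prob_space_unif)
  let ?S = "abs_shift_component f (record_set g)"
  note gm [measurable] = borel_measurable_usc[OF usc]
  note [measurable] = Z
  have [measurable]: "?S \<in> borel_measurable unif"
    by (intro measurable_abs_shift_component f zero_in_record_set closed_abs_record_set
        sets_record_set usc)
  show "(\<lambda>s. g (Z s)) \<in> borel_measurable unif" "(\<lambda>s. g (?S s)) \<in> borel_measurable unif"
    by measurable
  fix c :: real
  show "measure unif {s \<in> space unif. c \<le> g (Z s)} \<le> measure unif {s \<in> space unif. c \<le> g (?S s)}"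
  proof (cases "{x. c \<le> g x} = {}")
    case True
    then have "{s \<in> space unif. c \<le> g (Z s)} = {}" by auto
    then show ?thesis by (simp only: measure_empty measure_nonneg)
  next
    case False
    then obtain t where t: "c \<le> g t" "\<And>y. c \<le> g y \<Longrightarrow> \<bar>t\<bar> \<le> \<bar>y\<bar>"
      using distance_attains_inf[OF usc, of c 0] by (auto simp: dist_real_def)
    have "{s \<in> space unif. \<bar>t\<bar> \<le> \<bar>Z s\<bar>} \<in> sets unif" by measurable
    then have "measure unif {s \<in> space unif. c \<le> g (Z s)} \<le> measure unif {s \<in> {0<..<1}. \<bar>t\<bar> \<le> \<bar>Z s\<bar>}"
      using t by (intro finite_measure_mono) (auto simp: space_restrict_space)
    also have "\<dots> \<le> f \<bar>t\<bar>" by (rule tail) simp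
    also have "\<dots> = measure unif {s \<in> {0<..<1}. \<bar>t\<bar> \<le> tail_quantile f s}"
      using measure_tail_quantile_ge[OF f, of "\<bar>t\<bar>"] by simp
    also have "\<dots> \<le> measure unif {s \<in> space unif. c \<le> g (?S s)}"
    proof (rule finite_measure_mono)
      show "{s \<in> {0<..<1}. \<bar>t\<bar> \<le> tail_quantile f s} \<subseteq> {s \<in> space unif. c \<le> g (?S s)}"
        using abs_shift_component_record_set[OF f _ usc, of _ t] t(1)
        by (auto simp: space_restrict_space intro: order_trans)
    qed measurable
    finally show ?thesis .
  qed
qed (use g in auto)

section \<open>Hitting probabilities\<close>

lemma nn_integral_indicator_comp:
  assumes W: "W \<in> measurable M N" and V: "V \<in> sets N"
  shows "(\<integral>\<^sup>+ x. indicator V (W x) \<partial>M) = emeasure M {x \<in> space M. W x \<in> V}"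
proof -
  have "(\<integral>\<^sup>+ x. indicator V (W x) \<partial>M) = (\<integral>\<^sup>+ x. indicator {x \<in> space M. W x \<in> V} x \<partial>M)"
    by (intro nn_integral_cong) (simp add: indicator_def)
  moreover have "{x \<in> space M. W x \<in> V} \<in> sets M"
    using measurable_sets[OF W V] by (simp add: vimage_def Int_def conj_commute)
  ultimately show ?thesis by simp
qed

text \<open>Half of the portmanteau theorem: the complement of \<open>V\<close> is open, so the
  limsup of the indicators is at most the indicator at the limit, and the reverse Fatou lemma
  applies with dominating function 1. Used for slices, for tail bounds and for maximising
  sequences.\<close>

lemma measure_closed_limit_ge:
  fixes W :: "nat \<Rightarrow> 'a \<Rightarrow> 'b::topological_space"
  assumes "prob_space M" and [measurable]: "\<And>n. W n \<in> borel_measurable M" "W' \<in> borel_measurable M"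
    and lim: "AE x in M. (\<lambda>n. W n x) \<longlonglongrightarrow> W' x" and V: "closed V"
    and ge: "\<And>n. c \<le> measure M {x \<in> space M. W n x \<in> V}"
  shows "c \<le> measure M {x \<in> space M. W' x \<in> V}"
proof -
  interpret prob_space M by fact
  have Vb [measurable]: "V \<in> sets borel" using V by (rule borel_closed)
  have "ennreal c \<le> limsup (\<lambda>n. \<integral>\<^sup>+ x. indicator V (W n x) \<partial>M)"
  proof (rule le_Limsup)
    have "(\<integral>\<^sup>+ x. indicator V (W n x) \<partial>M) = emeasure M {x \<in> space M. W n x \<in> V}" for n
      by (rule nn_integral_indicator_comp[OF assms(2) Vb])
    then show "\<forall>\<^sub>F n in sequentially. ennreal c \<le> (\<integral>\<^sup>+ x. indicator V (W n x) \<partial>M)"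
      using ge by (simp add: emeasure_eq_measure ennreal_leI)
  qed simp
  also have "\<dots> \<le> (\<integral>\<^sup>+ x. limsup (\<lambda>n. indicator V (W n x)) \<partial>M)"
    by (rule nn_integral_limsup[where w = "\<lambda>_. 1"])
       (auto simp: indicator_def emeasure_space_1)
  also have "\<dots> \<le> (\<integral>\<^sup>+ x. indicator V (W' x) \<partial>M)"
  proof (rule nn_integral_mono_AE)
    show "AE x in M. limsup (\<lambda>n. indicator V (W n x)) \<le> (indicator V (W' x) :: ennreal)"
      using lim
    proof eventually_elim
      case (elim x)
      show ?case
      proof (cases "W' x \<in> V")
        case True
        then show ?thesis by (intro Limsup_bounded) (auto simp: indicator_def)
      next
        case False
        then have "\<forall>\<^sub>F n in sequentially. W n x \<in> - V"
          using V by (intro topological_tendstoD[OF elim]) auto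
        then have "\<forall>\<^sub>F n in sequentially. indicator V (W n x) \<le> (indicator V (W' x) :: ennreal)"
          by (rule eventually_mono) simp
        then show ?thesis by (rule Limsup_bounded)
      qed
    qed
  qed
  also have "\<dots> = emeasure M {x \<in> space M. W' x \<in> V}"
    by (rule nn_integral_indicator_comp[OF assms(3) Vb])
  finally show ?thesis by (simp add: emeasure_eq_measure)
qed

text \<open>After resampling coordinate \<open>k\<close> the inner integrand is constant, which
  leaves an integral over the marginal.\<close>

lemma emeasure_cube_component:
  assumes A: "A \<in> sets unif"
  shows "emeasure cube_measure {s :: real ^ 'n \<in> box 0 1. s $ k \<in> A} = emeasure unif A"
proof -
  interpret prob_space "cube_measure :: (real ^ 'n) measure" by (rule prob_space_cube_measure)
  have m: "(\<lambda>s :: real ^ 'n. indicator A (s $ k) :: ennreal) \<in> borel_measurable cube_measure"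
    using measurable_compose[OF measurable_cube_component borel_measurable_indicator[OF A]] .
  have "emeasure cube_measure {s :: real ^ 'n \<in> box 0 1. s $ k \<in> A}
      = (\<integral>\<^sup>+ s. indicator A (s $ k) \<partial>(cube_measure :: (real ^ 'n) measure))"
    by (simp add: nn_integral_indicator_comp[OF measurable_cube_component A] space_cube_measure)
  also have "\<dots> = (\<integral>\<^sup>+ x. indicator A x \<partial>unif)"
    by (subst nn_integral_cube_resample[OF m, of k]) (simp add: emeasure_space_1)
  finally show ?thesis using A by simp
qed

lemma measurable_product_rv:
  assumes "\<And>k. X k \<in> borel_measurable unif"
  shows "product_rv X \<in> borel_measurable (cube_measure :: (real ^ 'n) measure)"
  unfolding product_rv_def[abs_def]
  by (intro measurable_vec_lambda measurable_compose[OF measurable_cube_component assms])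

lemma measure_product_rv_component:
  fixes X :: "'n::finite \<Rightarrow> real \<Rightarrow> real"
  assumes X: "X k \<in> borel_measurable unif"
  shows "\<P>(s in cube_measure. \<bar>product_rv X s $ k\<bar> \<ge> t) = measure unif {s \<in> {0<..<1}. t \<le> \<bar>X k s\<bar>}"
proof -
  have "{s \<in> space unif. t \<le> \<bar>X k s\<bar>} \<in> sets unif" using X by measurable
  then have "{s \<in> {0<..<1}. t \<le> \<bar>X k s\<bar>} \<in> sets unif" by (simp add: space_restrict_space)
  from emeasure_cube_component[OF this, where 'n = 'n and k = k] show ?thesis
    by (auto simp: measure_def space_cube_measure product_rv_def mem_unit_cube_iff
        intro!: arg_cong[where f = enn2real] elim!: trans[rotated] intro!: arg_cong2[where f = emeasure])
qed

section \<open>Hitting probabilities as functions of a single coordinate\<close>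

definition hit_prob :: "(real ^ 'n) set \<Rightarrow> ('n \<Rightarrow> real \<Rightarrow> real) \<Rightarrow> real" where
  "hit_prob V X = \<P>(s in cube_measure. product_rv X s \<in> V)"

text \<open>By independence, the conditional probability of hitting \<open>V\<close> when component
  \<open>k\<close> is held at \<open>x\<close>.\<close>

definition slice_prob :: "(real ^ 'n) set \<Rightarrow> ('n \<Rightarrow> real \<Rightarrow> real) \<Rightarrow> 'n \<Rightarrow> real \<Rightarrow> real" where
  "slice_prob V X k x = \<P>(s in cube_measure. (\<chi> j. if j = k then x else X j (s $ j)) \<in> V)"

lemma measurable_slice:
  fixes X :: "'n::finite \<Rightarrow> real \<Rightarrow> real"
  assumes "\<And>j. X j \<in> borel_measurable unif"
  shows "(\<lambda>s. \<chi> j. if j = k then x else X j (s $ j)) \<in> borel_measurable (cube_measure :: (real ^ 'n) measure)"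
proof (rule measurable_vec_lambda)
  fix j show "(\<lambda>s :: real ^ 'n. if j = k then x else X j (s $ j)) \<in> borel_measurable cube_measure"
    by (cases "j = k") (simp_all add: measurable_compose[OF measurable_cube_component assms])
qed

text \<open>If \<open>x n\<close> converges to \<open>l\<close>, the vectors with component
  \<open>k\<close> frozen converge pointwise, and \<open>V\<close> is closed. This is the upper
  semicontinuity that record sets ask of \<open>g\<close>.\<close>

lemma closed_slice_prob_ge:
  assumes V: "closed V" and X: "\<And>j. X j \<in> borel_measurable unif"
  shows "closed {x. c \<le> slice_prob V X k x}"
  unfolding closed_sequential_limits
proof (intro allI impI, elim conjE)
  fix x l assume ge: "\<forall>n. x n \<in> {x. c \<le> slice_prob V X k x}" and lim: "x \<longlonglongrightarrow> l"
  have "c \<le> measure cube_measure {s \<in> space cube_measure. (\<chi> j. if j = k then l else X j (s $ j)) \<in> V}"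
  proof (rule measure_closed_limit_ge[OF prob_space_cube_measure _ _ _ V])
    fix n
    show "c \<le> measure cube_measure {s \<in> space cube_measure. (\<chi> j. if j = k then x n else X j (s $ j)) \<in> V}"
      using ge by (simp add: slice_prob_def)
    show "AE s in cube_measure. (\<lambda>n. \<chi> j. if j = k then x n else X j (s $ j))
        \<longlonglongrightarrow> (\<chi> j. if j = k then l else X j (s $ j))"
      using lim by (intro AE_I2 tendsto_vec_lambda) simp
  qed (intro measurable_slice X)+
  then show "l \<in> {x. c \<le> slice_prob V X k x}" by (simp add: slice_prob_def)
qed

text \<open>Resampling separates coordinate \<open>k\<close> from the others. The slice does not
  involve \<open>Z\<close>, so the choice of \<open>Z\<close> becomes a one-dimensional optimisation
  with a fixed integrand.\<close>

lemma hit_prob_fun_upd: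
  fixes X :: "'n::finite \<Rightarrow> real \<Rightarrow> real"
  assumes V: "closed V" and X: "\<And>j. X j \<in> borel_measurable unif" and Z: "Z \<in> borel_measurable unif"
  shows "ennreal (hit_prob V (X(k := Z))) = (\<integral>\<^sup>+ x. ennreal (slice_prob V X k (Z x)) \<partial>unif)"
proof -
  interpret prob_space "cube_measure :: (real ^ 'n) measure" by (rule prob_space_cube_measure)
  have Vb [measurable]: "V \<in> sets borel" using V by (rule borel_closed)
  have XZ: "product_rv (X(k := Z)) \<in> borel_measurable cube_measure"
    using X Z by (intro measurable_product_rv) auto
  have slice: "(\<lambda>s. \<chi> j. if j = k then x else X j (s $ j)) \<in> borel_measurable cube_measure" for x
    by (intro measurable_slice X)
  have m: "(\<lambda>s. indicator V (product_rv (X(k := Z)) s) :: ennreal) \<in> borel_measurable cube_measure"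
    by (rule measurable_compose[OF XZ borel_measurable_indicator[OF Vb]])
  have "ennreal (hit_prob V (X(k := Z))) = (\<integral>\<^sup>+ s. indicator V (product_rv (X(k := Z)) s) \<partial>cube_measure)"
    unfolding hit_prob_def emeasure_eq_measure[symmetric]
    by (rule nn_integral_indicator_comp[OF XZ Vb, symmetric])
  also have "\<dots> = (\<integral>\<^sup>+ x. (\<integral>\<^sup>+ s. indicator V (product_rv (X(k := Z)) (\<chi> j. if j = k then x else s $ j))
      \<partial>cube_measure) \<partial>unif)"
    by (rule nn_integral_cube_resample[OF m])
  also have "\<dots> = (\<integral>\<^sup>+ x. ennreal (slice_prob V X k (Z x)) \<partial>unif)"
  proof (rule nn_integral_cong)
    fix x
    have eq: "product_rv (X(k := Z)) (\<chi> j. if j = k then x else s $ j)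
        = (\<chi> j. if j = k then Z x else X j (s $ j))" for s
      by (simp add: product_rv_def vec_eq_iff)
    show "(\<integral>\<^sup>+ s. indicator V (product_rv (X(k := Z)) (\<chi> j. if j = k then x else s $ j)) \<partial>cube_measure)
        = ennreal (slice_prob V X k (Z x))"
      unfolding eq slice_prob_def emeasure_eq_measure[symmetric]
      by (rule nn_integral_indicator_comp[OF slice Vb])
  qed
  finally show ?thesis .
qed

lemma hit_prob_nonneg: "0 \<le> hit_prob V X"
  by (simp add: hit_prob_def)

text \<open>The hypothesis on \<open>X\<close> is measurability rather than neatness, so that the
  lemma still applies once other coordinates have been shifted and have lost monotonicity.\<close>

lemma hit_prob_le_shift_component:
  fixes X :: "'n::finite \<Rightarrow> real \<Rightarrow> real"
  assumes f: "f \<in> tail_bounds" and V: "closed V" and X: "\<And>j. X j \<in> borel_measurable unif"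
    and tail: "\<And>t. 0 \<le> t \<Longrightarrow> measure unif {s \<in> {0<..<1}. t \<le> \<bar>X k s\<bar>} \<le> f t"
  shows "hit_prob V X \<le> hit_prob V (X(k := abs_shift_component f (record_set (slice_prob V X k))))"
proof -
  note usc = closed_slice_prob_ge[OF V X]
  have S: "abs_shift_component f (record_set (slice_prob V X k)) \<in> borel_measurable unif"
    by (intro measurable_abs_shift_component f zero_in_record_set closed_abs_record_set
        sets_record_set usc)
  \<comment> \<open>The trivial update \<open>X(k := X k)\<close> makes both sides expectations of
    the same slice.\<close>
  have "ennreal (hit_prob V (X(k := X k)))
      \<le> ennreal (hit_prob V (X(k := abs_shift_component f (record_set (slice_prob V X k)))))"
    unfolding hit_prob_fun_upd[OF V X X] hit_prob_fun_upd[OF V X S]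
    by (rule nn_integral_le_abs_shift_component[OF f usc _ X tail]) (simp_all add: slice_prob_def)
  then show ?thesis by (simp add: hit_prob_nonneg)
qed

text \<open>Induction over the set \<open>A\<close> of coordinates already shifted. Each new record
  set is formed from the slice in which the earlier replacements are in place, so it depends on the
  order of replacement.\<close>

lemma hit_prob_le_shift:
  fixes f :: "'n::finite \<Rightarrow> real \<Rightarrow> real"
  assumes f: "\<And>k. f k \<in> tail_bounds" and V: "closed V" and X: "\<And>j. X j \<in> borel_measurable unif"
    and tail: "\<And>k t. 0 \<le> t \<Longrightarrow> measure unif {s \<in> {0<..<1}. t \<le> \<bar>X k s\<bar>} \<le> f k t"
  shows "\<exists>G. (\<forall>k. 0 \<in> G k \<and> closed (abs ` G k) \<and> G k \<in> sets borel) \<and>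
    hit_prob V X \<le> hit_prob V (\<lambda>k. abs_shift_component (f k) (G k))"
proof -
  let ?S = "\<lambda>A G k. if k \<in> A then abs_shift_component (f k) (G k) else X k"
  have "\<exists>G. (\<forall>k. 0 \<in> G k \<and> closed (abs ` G k) \<and> G k \<in> sets borel) \<and>
    hit_prob V X \<le> hit_prob V (?S A G)" for A
    using finite[of A]
  proof (induction A)
    case empty
    show ?case by (intro exI[of _ "\<lambda>_. {0}"]) simp
  next
    case (insert k A)
    then obtain G where G: "\<And>j. 0 \<in> G j" "\<And>j. closed (abs ` G j)" "\<And>j. G j \<in> sets borel"
      and le: "hit_prob V X \<le> hit_prob V (?S A G)" by blast
    let ?G = "G(k := record_set (slice_prob V (?S A G) k))"
    have S: "?S A G j \<in> borel_measurable unif" for j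
      using X measurable_abs_shift_component[OF f G] by simp
    note usc = closed_slice_prob_ge[OF V S, where k = k]
    have "hit_prob V (?S A G)
        \<le> hit_prob V ((?S A G)(k := abs_shift_component (f k) (record_set (slice_prob V (?S A G) k))))"
      \<comment> \<open>Coordinate \<open>k\<close> is not in \<open>A\<close>, so it is still the
        original \<open>X k\<close> and keeps its tail bound.\<close>
      by (rule hit_prob_le_shift_component[OF f V S]) (simp only: insert(2) if_False tail)
    also have "(?S A G)(k := abs_shift_component (f k) (record_set (slice_prob V (?S A G) k)))
        = ?S (insert k A) ?G"
      using insert(2) by (auto simp: fun_eq_iff)
    finally have "hit_prob V X \<le> hit_prob V (?S (insert k A) ?G)" using le by simp
    moreover have "\<forall>j. 0 \<in> ?G j \<and> closed (abs ` ?G j) \<and> ?G j \<in> sets borel"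
      using G zero_in_record_set closed_abs_record_set[OF usc] sets_record_set[OF usc]
      by (simp only: fun_upd_apply) simp
    ultimately show ?case by blast
  qed
  from this[of UNIV] show ?thesis by simp
qed

text \<open>By independence only the marginal laws matter. Coordinates are exchanged one at a time:
  in \<open>hit_prob_fun_upd\<close> the updated component enters through its law alone.\<close>

lemma hit_prob_cong_distr:
  fixes X :: "'n::finite \<Rightarrow> real \<Rightarrow> real"
  assumes V: "closed V" and X: "\<And>j. X j \<in> borel_measurable unif" and Z: "\<And>j. Z j \<in> borel_measurable unif"
    and eq: "\<And>j. distr unif borel (X j) = distr unif borel (Z j)"
  shows "hit_prob V X = hit_prob V Z"
proof -
  have "hit_prob V (\<lambda>k. if k \<in> A then X k else Z k) = hit_prob V Z" for A
    using finite[of A]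
  proof (induction A)
    case (insert k A)
    let ?W = "\<lambda>k. if k \<in> A then X k else Z k"
    have W: "?W j \<in> borel_measurable unif" for j using X Z by simp
    note [measurable] = borel_measurable_usc[OF closed_slice_prob_ge[OF V W]]
    have law: "ennreal (hit_prob V (?W(k := Y))) = (\<integral>\<^sup>+ y. ennreal (slice_prob V ?W k y) \<partial>distr unif borel Y)"
      if "Y \<in> borel_measurable unif" for Y
      unfolding hit_prob_fun_upd[OF V W that] using that by (subst nn_integral_distr) simp_all
    have "ennreal (hit_prob V (?W(k := X k))) = ennreal (hit_prob V (?W(k := Z k)))"
      unfolding law[OF X] law[OF Z] eq ..
    then have "hit_prob V (?W(k := X k)) = hit_prob V (?W(k := Z k))"
      by (simp only: ennreal_inj[OF hit_prob_nonneg hit_prob_nonneg])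
    moreover have "?W(k := X k) = (\<lambda>j. if j \<in> insert k A then X j else Z j)" "?W(k := Z k) = ?W"
      using insert(2) by (auto simp: fun_eq_iff)
    ultimately show ?case using insert(3) by simp
  qed simp
  from this[of UNIV] show ?thesis by simp
qed

section \<open>Neat functions and monotone rearrangement\<close>

lemma measurable_neat: "neat X \<Longrightarrow> X \<in> borel_measurable unif"
  using borel_measurable_mono_on_fnc[of "{0<..<1}" X]
  by (simp add: neat_def cong: measurable_cong_sets sets_restrict_space_cong)

text \<open>\<open>D.I\<close> is the generalised inverse of the distribution function of
  \<open>X\<close>: it is monotone on the unit interval and has the law of \<open>X\<close> under
  the uniform measure.\<close>

lemma neat_rearrangement:
  assumes X: "X \<in> borel_measurable unif"
  obtains Z where "neat Z" "distr unif borel Z = distr unif borel X"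
proof -
  interpret prob_space unif by (rule prob_space_unif)
  interpret D: cdf_distribution "distr unif borel X"
    unfolding cdf_distribution_def using X by (rule real_distribution_distr)
  show ?thesis
    using that[of D.I] D.mono_I D.distr_I_eq_M by (simp add: neat_def)
qed

section \<open>Attainment of the supremum\<close>

lemma distr_cube_component: "distr cube_measure unif (\<lambda>s :: real ^ 'n. s $ k) = unif"
proof (rule measure_eqI)
  fix A assume "A \<in> sets (distr cube_measure unif (\<lambda>s :: real ^ 'n. s $ k))"
  then have A: "A \<in> sets unif" by simp
  have "(\<lambda>s :: real ^ 'n. s $ k) -` A \<inter> space cube_measure = {s \<in> box 0 1. s $ k \<in> A}"
    by (auto simp: space_cube_measure)
  then show "emeasure (distr cube_measure unif (\<lambda>s :: real ^ 'n. s $ k)) A = emeasure unif A"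
    using emeasure_cube_component[OF A] A by (simp add: emeasure_distr[OF measurable_cube_component])
qed simp

lemma AE_cube_component: "AE x in unif. P x \<Longrightarrow> AE s :: real ^ 'n in cube_measure. P (s $ k)"
  by (rule AE_distrD[OF measurable_cube_component]) (simp only: distr_cube_component)

text \<open>Bolzano-Weierstrass at each point of an enumeration of \<open>S\<close>, followed by
  Cantor's diagonal argument.\<close>

lemma convergent_subsequence_countable:
  fixes F :: "nat \<Rightarrow> 'i \<Rightarrow> real"
  assumes "countable S" and bdd: "\<And>x. x \<in> S \<Longrightarrow> bounded (range (\<lambda>n. F n x))"
  shows "\<exists>r. strict_mono (r :: nat \<Rightarrow> nat) \<and> (\<forall>x\<in>S. convergent (\<lambda>n. F (r n) x))"
proof (cases "S = {}")
  case True
  then show ?thesis by (intro exI[of _ id]) (simp add: strict_mono_def)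
next
  case False
  define e where "e = from_nat_into S"
  have e: "range e = S" using range_from_nat_into[OF False \<open>countable S\<close>] by (simp add: e_def)
  interpret subseqs "\<lambda>n s. convergent (\<lambda>k. F (s k) (e n))"
  proof
    fix n and s :: "nat \<Rightarrow> nat" assume "strict_mono s"
    have "bounded (range (\<lambda>k. F (s k) (e n)))"
      using bdd[of "e n"] e by (auto intro: bounded_subset)
    then obtain l r where "strict_mono (r :: nat \<Rightarrow> nat)" "((\<lambda>k. F (s k) (e n)) \<circ> r) \<longlonglongrightarrow> l"
      using bounded_imp_convergent_subsequence by blast
    then show "\<exists>r. strict_mono r \<and> convergent (\<lambda>k. F ((s \<circ> r) k) (e n))"
      by (auto simp: convergent_def o_def)
  qed
  have "convergent (\<lambda>k. F (diagseq k) (e n))" for n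
  proof -
    \<comment> \<open>The diagonal sequence refines the subsequence chosen for \<open>e n\<close>
      only from index \<open>Suc n\<close> on; the initial segment is restored afterwards.\<close>
    have "convergent (\<lambda>k. F ((diagseq \<circ> (+) (Suc n)) k) (e n))"
    proof (rule diagseq_holds)
      fix r s :: "nat \<Rightarrow> nat" and m
      assume "strict_mono r" "convergent (\<lambda>k. F (s k) (e m))"
      then show "convergent (\<lambda>k. F ((s \<circ> r) k) (e m))"
        using convergent_subseq_convergent[of "\<lambda>k. F (s k) (e m)" r] by (simp add: o_def)
    qed
    then have "convergent (\<lambda>k. F (diagseq (k + Suc n)) (e n))"
      by (simp add: o_def add.commute)
    then show ?thesis using convergent_ignore_initial_segment[of "\<lambda>k. F (diagseq k) (e n)"] by blast
  qed
  then show ?thesis using subseq_diagseq e by blast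
qed

text \<open>Helly's selection theorem. A diagonal subsequence converges at all rationals of the
  interval. Squeezing between rationals gives convergence at every continuity point of
  \<open>Y\<close>, and the monotone \<open>Y\<close> has only countably many
  discontinuities.\<close>

lemma neat_selection:
  fixes X :: "nat \<Rightarrow> 'n::finite \<Rightarrow> real \<Rightarrow> real"
  assumes neat: "\<And>n k. neat (X n k)" and bdd: "\<And>k s. s \<in> {0<..<1} \<Longrightarrow> bounded (range (\<lambda>n. X n k s))"
  shows "\<exists>r Y. strict_mono (r :: nat \<Rightarrow> nat) \<and> (\<forall>k. neat (Y k) \<and> (AE s in unif. (\<lambda>n. X (r n) k s) \<longlonglongrightarrow> Y k s))"
proof -
  let ?Q = "\<rat> \<inter> {0<..<1::real}"
  have "countable (UNIV \<times> ?Q :: ('n \<times> real) set)"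
    by (intro countable_SIGMA countable_Int1 countable_rat countable_finite) simp
  moreover have "bounded (range (\<lambda>n. case x of (k, q) \<Rightarrow> X n k q))" if "x \<in> UNIV \<times> ?Q" for x
    using that by (auto intro: bdd)
  ultimately obtain r where r: "strict_mono (r :: nat \<Rightarrow> nat)"
    and conv: "\<forall>x\<in>UNIV \<times> ?Q. convergent (\<lambda>n. case x of (k, q) \<Rightarrow> X (r n) k q)"
    using convergent_subsequence_countable[of "UNIV \<times> ?Q" "\<lambda>n (k, q). X n k q"] by blast
  define L where "L k q = lim (\<lambda>n. X (r n) k q)" for k q
  \<comment> \<open>The supremum runs over rationals strictly below \<open>s\<close>, so
    \<open>Y\<close> is built from left limits of the rational limits \<open>L\<close>.\<close>
  define Y where "Y k s = Sup (L k ` (?Q \<inter> {..<s}))" for k s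
  have L: "(\<lambda>n. X (r n) k q) \<longlonglongrightarrow> L k q" if "q \<in> ?Q" for k q
  proof -
    have "(k, q) \<in> UNIV \<times> ?Q" using that by simp
    from bspec[OF conv this] show ?thesis unfolding L_def by (simp add: convergent_LIMSEQ_iff)
  qed
  have mono: "X n k a \<le> X n k b" if "a \<in> {0<..<1}" "b \<in> {0<..<1}" "a \<le> b" for n k a b
    using neat[of n k] that unfolding neat_def by (rule mono_onD)
  have L_mono: "L k p \<le> L k q" if "p \<in> ?Q" "q \<in> ?Q" "p \<le> q" for k p q
  proof (rule LIMSEQ_le[OF L L])
    have "X (r n) k p \<le> X (r n) k q" for n using that by (intro mono) auto
    then show "\<exists>N. \<forall>n\<ge>N. X (r n) k p \<le> X (r n) k q" by blast
  qed (fact that)+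
  have dense: "\<exists>q\<in>?Q. a < q \<and> q < b" if "a < b" "0 \<le> a" "b \<le> 1" for a b
  proof -
    obtain q where "q \<in> \<rat>" "a < q" "q < b" using Rats_dense_in_real[OF \<open>a < b\<close>] by blast
    then show ?thesis using that by (intro bexI[of _ q]) auto
  qed
  have bddL: "bdd_above (L k ` (?Q \<inter> {..<s}))" if s: "s \<in> {0<..<1}" for k s
  proof -
    obtain q where "q \<in> ?Q" "s < q" using dense[of s 1] s by auto
    then show ?thesis by (intro bdd_aboveI2[of _ _ "L k q"] L_mono) auto
  qed
  have neL: "L k ` (?Q \<inter> {..<s}) \<noteq> {}" if s: "s \<in> {0<..<1}" for k s
    using dense[of 0 s] s by auto
  have neatY: "neat (Y k)" for k
    unfolding neat_def
  proof (rule mono_onI)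
    fix s u :: real assume s: "s \<in> {0<..<1}" and u: "u \<in> {0<..<1}" and "s \<le> u"
    show "Y k s \<le> Y k u"
      unfolding Y_def by (intro cSup_subset_mono neL s bddL u image_mono) (use \<open>s \<le> u\<close> in auto)
  qed
  have lim: "(\<lambda>n. X (r n) k s) \<longlonglongrightarrow> Y k s" if s: "s \<in> {0<..<1}" and cont: "isCont (Y k) s" for k s
  proof (rule order_tendstoI)
    fix a assume "a < Y k s"
    then obtain q where q: "q \<in> ?Q" "q < s" "a < L k q"
      unfolding Y_def using less_cSupD[OF neL[OF s]] by blast
    have "\<forall>\<^sub>F n in sequentially. a < X (r n) k q"
      by (rule order_tendstoD(1)[OF L[OF q(1)] q(3)])
    then show "\<forall>\<^sub>F n in sequentially. a < X (r n) k s"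
    proof (rule eventually_mono)
      fix n assume "a < X (r n) k q"
      also have "\<dots> \<le> X (r n) k s" using q s by (intro mono) auto
      finally show "a < X (r n) k s" .
    qed
  next
    fix a assume a: "Y k s < a"
    \<comment> \<open>Upper half of the squeeze: right continuity keeps \<open>Y k x < a\<close> for
      some \<open>x > s\<close>, and a rational \<open>q\<close> between \<open>s\<close> and
      \<open>x\<close> satisfies \<open>L k q <= Y k x\<close>.\<close>
    have "(Y k \<longlongrightarrow> Y k s) (at_right s)"
      using cont by (simp add: isCont_def filterlim_at_split)
    then have "\<forall>\<^sub>F x in at_right s. Y k x < a" using a by (rule order_tendstoD(2))
    then obtain b where b: "s < b" "\<And>x. s < x \<Longrightarrow> x < b \<Longrightarrow> Y k x < a"
      unfolding eventually_at_right_field by auto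
    obtain x where x: "s < x" "x < min b 1" using b(1) s dense_order_class.dense[of s "min b 1"] by auto
    obtain q where q: "q \<in> ?Q" "s < q" "q < x" using dense[of s x] x s by auto
    have "L k q \<le> Y k x"
      unfolding Y_def using q x s by (intro cSup_upper bddL) auto
    also have "\<dots> < a" using b x by simp
    finally have "\<forall>\<^sub>F n in sequentially. X (r n) k q < a"
      by (rule order_tendstoD(2)[OF L[OF q(1)]])
    then show "\<forall>\<^sub>F n in sequentially. X (r n) k s < a"
    proof (rule eventually_mono)
      fix n
      have "X (r n) k s \<le> X (r n) k q" using q s by (intro mono) auto
      also assume "X (r n) k q < a"
      finally show "X (r n) k s < a" .
    qed
  qed
  have "AE s in unif. (\<lambda>n. X (r n) k s) \<longlonglongrightarrow> Y k s" for k
  proof -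
    have "countable {s \<in> {0<..<1}. \<not> isCont (Y k) s}"
      using neatY[of k] by (intro mono_on_ctble_discont_open) (auto simp: neat_def)
    then have "AE s in lborel. s \<notin> {s \<in> {0<..<1}. \<not> isCont (Y k) s}"
      by (intro AE_not_in countable_imp_null_set_lborel)
    then have "AE s in lborel. s \<in> {0<..<1} \<longrightarrow> (\<lambda>n. X (r n) k s) \<longlonglongrightarrow> Y k s"
      by eventually_elim (use lim in auto)
    then show ?thesis by (subst AE_restrict_space_iff) auto
  qed
  then show ?thesis using r neatY by blast
qed

section \<open>Compactness of the class of tail bounded neat functions\<close>

definition tail_bounded_neat :: "(real \<Rightarrow> real) \<Rightarrow> (real \<Rightarrow> real) \<Rightarrow> bool" where
  "tail_bounded_neat f X \<longleftrightarrow>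
    neat X \<and> (\<forall>t\<ge>0. measure unif {s \<in> {0<..<1}. t \<le> \<bar>X s\<bar>} \<le> f t)"

text \<open>The tail conditions concern only marginals, so the admissible class is a product of
  one-coordinate classes.\<close>

lemma tail_bounded_rvs_eq:
  "tail_bounded_rvs f = product_rv ` {X. \<forall>k. tail_bounded_neat (f k) (X k)}"
proof (intro equalityI subsetI)
  fix x assume x: "x \<in> tail_bounded_rvs f"
  then obtain X where X: "x = product_rv X" "\<forall>k. neat (X k)"
    by (auto simp: tail_bounded_rvs_def neat_products_def)
  then have "\<forall>k. tail_bounded_neat (f k) (X k)"
    using x measure_product_rv_component[OF measurable_neat, of X]
    by (simp add: tail_bounded_rvs_def tail_bounded_neat_def)
  then show "x \<in> product_rv ` {X. \<forall>k. tail_bounded_neat (f k) (X k)}" using X by blast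
next
  fix x assume "x \<in> product_rv ` {X. \<forall>k. tail_bounded_neat (f k) (X k)}"
  then obtain X where X: "x = product_rv X" "\<forall>k. tail_bounded_neat (f k) (X k)" by blast
  then show "x \<in> tail_bounded_rvs f"
    using measure_product_rv_component[OF measurable_neat, of X]
    by (auto simp: tail_bounded_rvs_def tail_bounded_neat_def neat_products_def)
qed

lemma measure_unif_interval:
  assumes "0 \<le> a" "a \<le> b" "b \<le> 1"
  shows "measure unif {a<..<b} = b - a"
  using assms by (subst measure_restrict_space) auto

text \<open>If \<open>|X s| > B\<close>, monotonicity forces \<open>|X| >= B\<close> on all of
  \<open>(s, 1)\<close> or all of \<open>(0, s)\<close>, so \<open>f B\<close> would be at least
  \<open>1 - s\<close> or \<open>s\<close>. The bound is uniform over the class, as Helly selection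
  requires.\<close>

lemma tail_bounded_neat_bounded:
  assumes f: "f \<in> tail_bounds" and s: "s \<in> {0<..<1}"
  shows "\<exists>B. \<forall>X. tail_bounded_neat f X \<longrightarrow> \<bar>X s\<bar> \<le> B"
proof -
  interpret prob_space unif by (rule prob_space_unif)
  have "\<forall>\<^sub>F t in at_top. f t < min s (1 - s)"
    using f s by (intro order_tendstoD(2)[of f 0]) (auto simp: tail_bounds_def)
  then obtain B' where B': "\<And>t. t \<ge> B' \<Longrightarrow> f t < min s (1 - s)" by (auto simp: eventually_at_top_linorder)
  define B where "B = max B' 0"
  have B: "0 \<le> B" "f B < s" "f B < 1 - s" using B'[of B] by (auto simp: B_def)
  have "\<bar>X s\<bar> \<le> B" if X: "tail_bounded_neat f X" for X
  proof (rule ccontr)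
    assume *: "\<not> \<bar>X s\<bar> \<le> B"
    have mono: "\<And>a b. a \<in> {0<..<1} \<Longrightarrow> b \<in> {0<..<1} \<Longrightarrow> a \<le> b \<Longrightarrow> X a \<le> X b"
      using X unfolding tail_bounded_neat_def neat_def by (blast dest: mono_onD)
    have [measurable]: "X \<in> borel_measurable unif"
      using X measurable_neat by (simp add: tail_bounded_neat_def)
    have "{s \<in> space unif. B \<le> \<bar>X s\<bar>} \<in> sets unif" by measurable
    then have ev: "{s \<in> {0<..<1}. B \<le> \<bar>X s\<bar>} \<in> sets unif" by (simp add: space_restrict_space)
    have le: "measure unif {s \<in> {0<..<1}. B \<le> \<bar>X s\<bar>} \<le> f B"
      using X B(1) by (simp add: tail_bounded_neat_def)
    consider "B < X s" | "X s < - B" using * by linarith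
    then show False
    proof cases
      case 1
      have "{s<..<1} \<subseteq> {s \<in> {0<..<1}. B \<le> \<bar>X s\<bar>}"
      proof
        fix u assume "u \<in> {s<..<1}"
        then show "u \<in> {s \<in> {0<..<1}. B \<le> \<bar>X s\<bar>}" using mono[of s u] s 1 by auto
      qed
      from finite_measure_mono[OF this ev] have "1 - s \<le> f B"
        using measure_unif_interval[of s 1] s le by simp
      then show False using B by simp
    next
      case 2
      have "{0<..<s} \<subseteq> {s \<in> {0<..<1}. B \<le> \<bar>X s\<bar>}"
      proof
        fix u assume "u \<in> {0<..<s}"
        then show "u \<in> {s \<in> {0<..<1}. B \<le> \<bar>X s\<bar>}" using mono[of u s] s 2 by auto
      qed
      from finite_measure_mono[OF this ev] have "s \<le> f B"
        using measure_unif_interval[of 0 s] s le by simp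
      then show False using B by simp
    qed
  qed
  then show ?thesis by blast
qed

text \<open>The event \<open>|Y| > u\<close> is the complement of hitting the closed interval
  \<open>[-u, u]\<close>, so its bound passes to the limit. The event \<open>|Y| >= t\<close> is
  contained in it for every \<open>u < t\<close>, and left continuity of \<open>f\<close> lets
  \<open>u\<close> tend to \<open>t\<close>.\<close>

lemma tail_bounded_neat_limit:
  assumes f: "f \<in> tail_bounds" and X: "\<And>n. tail_bounded_neat f (X n)" and Y: "neat Y"
    and lim: "AE s in unif. (\<lambda>n. X n s) \<longlonglongrightarrow> Y s"
  shows "tail_bounded_neat f Y"
  unfolding tail_bounded_neat_def
proof (intro conjI Y allI impI)
  interpret prob_space unif by (rule prob_space_unif)
  have Xm [measurable]: "X n \<in> borel_measurable unif" for n
    using X[of n] measurable_neat by (simp add: tail_bounded_neat_def)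
  have Ym [measurable]: "Y \<in> borel_measurable unif" using Y by (rule measurable_neat)
  have compl: "measure unif {s \<in> space unif. Z s \<in> {- u..u}} = 1 - measure unif {s \<in> space unif. u < \<bar>Z s\<bar>}"
    if [measurable]: "Z \<in> borel_measurable unif" for Z :: "real \<Rightarrow> real" and u
  proof -
    have "{s \<in> space unif. Z s \<in> {- u..u}} = space unif - {s \<in> space unif. u < \<bar>Z s\<bar>}"
      by auto
    moreover have "{s \<in> space unif. u < \<bar>Z s\<bar>} \<in> sets unif" by measurable
    ultimately show ?thesis using prob_compl by simp
  qed
  have strict: "measure unif {s \<in> space unif. u < \<bar>Y s\<bar>} \<le> f u" if "0 \<le> u" for u
  proof -
    have "1 - f u \<le> measure unif {s \<in> space unif. X n s \<in> {- u..u}}" for n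
    proof -
      have "{s \<in> space unif. u \<le> \<bar>X n s\<bar>} \<in> sets unif" by measurable
      then have "measure unif {s \<in> space unif. u < \<bar>X n s\<bar>} \<le> measure unif {s \<in> space unif. u \<le> \<bar>X n s\<bar>}"
        by (intro finite_measure_mono) auto
      also have "\<dots> \<le> f u"
        using X[of n] \<open>0 \<le> u\<close> by (simp add: tail_bounded_neat_def space_restrict_space)
      finally show ?thesis unfolding compl[OF Xm] by simp
    qed
    then have "1 - f u \<le> measure unif {s \<in> space unif. Y s \<in> {- u..u}}"
      by (rule measure_closed_limit_ge[OF prob_space_unif Xm Ym lim closed_atLeastAtMost])
    then show ?thesis unfolding compl[OF Ym] by simp
  qed
  fix t :: real assume "0 \<le> t"
  show "measure unif {s \<in> {0<..<1}. t \<le> \<bar>Y s\<bar>} \<le> f t"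
  proof (cases "t = 0")
    \<comment> \<open>At 0 the bound is \<open>f 0 = 1\<close>; the approach from the left with
      \<open>u > 0\<close> covers only \<open>t > 0\<close>.\<close>
    case True
    then show ?thesis using f by (simp add: tail_bounds_def)
  next
    case False
    with \<open>0 \<le> t\<close> have "0 < t" by simp
    then have "(f \<longlongrightarrow> f t) (at_left t)"
      using f by (auto simp: tail_bounds_def continuous_within)
    moreover have "\<forall>\<^sub>F u in at_left t. measure unif {s \<in> {0<..<1}. t \<le> \<bar>Y s\<bar>} \<le> f u"
      unfolding eventually_at_left[OF \<open>0 < t\<close>]
    proof (intro exI[of _ 0] conjI \<open>0 < t\<close> allI impI)
      fix u assume u: "0 < u" "u < t"
      have "{s \<in> space unif. u < \<bar>Y s\<bar>} \<in> sets unif" by measurable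
      then have "measure unif {s \<in> {0<..<1}. t \<le> \<bar>Y s\<bar>} \<le> measure unif {s \<in> space unif. u < \<bar>Y s\<bar>}"
        using u by (intro finite_measure_mono) (auto simp: space_restrict_space)
      also have "\<dots> \<le> f u" using strict u by simp
      finally show "measure unif {s \<in> {0<..<1}. t \<le> \<bar>Y s\<bar>} \<le> f u" .
    qed
    ultimately show ?thesis by (intro tendsto_lowerbound[of f "f t" "at_left t"]) auto
  qed
qed

text \<open>Direct method: a maximising sequence, Helly selection in all coordinates at once, and
  upper semicontinuity of the hitting probability along almost everywhere limits.\<close>

lemma hit_prob_attains_max:
  fixes f :: "'n::finite \<Rightarrow> real \<Rightarrow> real"
  assumes f: "\<And>k. f k \<in> tail_bounds" and V: "closed V" and ne: "\<exists>X. \<forall>k. tail_bounded_neat (f k) (X k)"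
  shows "\<exists>Y. (\<forall>k. tail_bounded_neat (f k) (Y k)) \<and>
    (\<forall>X. (\<forall>k. tail_bounded_neat (f k) (X k)) \<longrightarrow> hit_prob V X \<le> hit_prob V Y)"
proof -
  interpret prob_space "cube_measure :: (real ^ 'n) measure" by (rule prob_space_cube_measure)
  let ?T = "{X. \<forall>k. tail_bounded_neat (f k) (X k)}"
  define M where "M = Sup (hit_prob V ` ?T)"
  have bdd: "bdd_above (hit_prob V ` ?T)"
    by (intro bdd_aboveI2[of _ _ 1]) (simp add: hit_prob_def)
  have upper: "hit_prob V X \<le> M" if "X \<in> ?T" for X
    unfolding M_def using that bdd by (intro cSup_upper) auto
  have "\<exists>X\<in>?T. M - 1 / Suc n < hit_prob V X" for n
  proof -
    have "M - 1 / Suc n < M" by simp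
    moreover have "hit_prob V ` ?T \<noteq> {}" using ne by blast
    ultimately show ?thesis
      using less_cSupD[of "hit_prob V ` ?T" "M - 1 / Suc n"] unfolding M_def by blast
  qed
  then have "\<exists>X. \<forall>n. X n \<in> ?T \<and> M - 1 / Suc n < hit_prob V (X n)"
    by (intro choice) blast
  then obtain X where X: "\<And>n k. tail_bounded_neat (f k) (X n k)" "\<And>n. M - 1 / Suc n < hit_prob V (X n)"
    by blast
  have "bounded (range (\<lambda>n. X n k s))" if s: "s \<in> {0<..<1}" for k s
  proof -
    obtain B where "\<forall>X. tail_bounded_neat (f k) X \<longrightarrow> \<bar>X s\<bar> \<le> B"
      using tail_bounded_neat_bounded[OF f s] by blast
    then have "\<bar>X n k s\<bar> \<le> B" for n using X(1) by blast
    then show ?thesis by (intro boundedI[of _ B]) auto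
  qed
  moreover have "neat (X n k)" for n k using X(1)[of k n] by (simp add: tail_bounded_neat_def)
  ultimately obtain r Y where r: "strict_mono (r :: nat \<Rightarrow> nat)" and Y: "\<And>k. neat (Y k)"
    and lim: "\<And>k. AE s in unif. (\<lambda>n. X (r n) k s) \<longlonglongrightarrow> Y k s"
    using neat_selection[of X] by blast
  have "\<forall>k. tail_bounded_neat (f k) (Y k)"
    using tail_bounded_neat_limit[OF f _ Y lim] X(1) by blast
  moreover have "M \<le> hit_prob V Y"
  proof (rule dense_le)
    fix c assume "c < M"
    \<comment> \<open>Shifting the sequence by \<open>N\<close> gives \<open>r (n + N) >= N\<close>,
      so every term, not just almost all, has hitting probability above \<open>c\<close>.\<close>
    then obtain N where N: "1 / Suc N < M - c"
      using reals_Archimedean[of "M - c"] by (auto simp: inverse_eq_divide)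
    show "c \<le> hit_prob V Y"
      unfolding hit_prob_def
    proof (rule measure_closed_limit_ge[OF prob_space_cube_measure _ _ _ V])
      fix n
      show "product_rv (X (r (n + N))) \<in> borel_measurable cube_measure"
        using X(1) measurable_neat by (intro measurable_product_rv) (simp add: tail_bounded_neat_def)
      have "N \<le> r (n + N)" using seq_suble[OF r, of "n + N"] by simp
      then have "1 / Suc (r (n + N)) \<le> 1 / Suc N" by (intro divide_left_mono) auto
      then show "c \<le> measure cube_measure {s \<in> space cube_measure. product_rv (X (r (n + N))) s \<in> V}"
        using X(2)[of "r (n + N)"] N by (simp add: hit_prob_def)
    next
      show "product_rv Y \<in> borel_measurable cube_measure"
        using Y measurable_neat by (intro measurable_product_rv) simp
      have "AE s in cube_measure. \<forall>k\<in>UNIV. (\<lambda>n. X (r n) k (s $ k)) \<longlonglongrightarrow> Y k (s $ k)"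
        by (intro AE_finite_allI AE_cube_component lim) simp
      then show "AE s in cube_measure. (\<lambda>n. product_rv (X (r (n + N))) s) \<longlonglongrightarrow> product_rv Y s"
      proof eventually_elim
        case (elim s)
        then show ?case
          unfolding product_rv_def by (intro tendsto_vec_lambda LIMSEQ_ignore_initial_segment) simp
      qed
    qed
  qed
  ultimately show ?thesis
    using upper by (intro exI[of _ Y] conjI allI impI) (blast intro: order_trans)+
qed

text \<open>A shifted component may change sign and fail to be monotone. Its rearrangement has the
  same law, hence the same tails, and so is an admissible competitor.\<close>

lemma tail_bounded_neat_shift_rearrangement:
  assumes f: "f \<in> tail_bounds" and G: "0 \<in> G" "closed (abs ` G)" "G \<in> sets borel"
  obtains Z where "tail_bounded_neat f Z" "distr unif borel Z = distr unif borel (abs_shift_component f G)"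
proof -
  have S: "abs_shift_component f G \<in> borel_measurable unif"
    by (rule measurable_abs_shift_component[OF f G])
  obtain Z where Z: "neat Z" "distr unif borel Z = distr unif borel (abs_shift_component f G)"
    using neat_rearrangement[OF S] .
  have Zm: "Z \<in> borel_measurable unif" using Z(1) by (rule measurable_neat)
  have law: "measure unif {s \<in> {0<..<1}. t \<le> \<bar>W s\<bar>} = measure (distr unif borel W) {x. t \<le> \<bar>x\<bar>}"
    if "W \<in> borel_measurable unif" for W :: "real \<Rightarrow> real" and t
  proof -
    have "{x :: real. t \<le> \<bar>x\<bar>} \<in> sets borel" by measurable
    moreover have "W -` {x. t \<le> \<bar>x\<bar>} \<inter> space unif = {s \<in> {0<..<1}. t \<le> \<bar>W s\<bar>}"
      by (auto simp: space_restrict_space)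
    ultimately show ?thesis using measure_distr[OF that] by simp
  qed
  have "tail_bounded_neat f Z"
    unfolding tail_bounded_neat_def
  proof (intro conjI Z(1) allI impI)
    fix t :: real assume "0 \<le> t"
    have "measure unif {s \<in> {0<..<1}. t \<le> \<bar>Z s\<bar>}
        = measure unif {s \<in> {0<..<1}. t \<le> \<bar>abs_shift_component f G s\<bar>}"
      unfolding law[OF Zm] law[OF S] Z(2) ..
    also have "\<dots> \<le> f t" by (rule measure_abs_shift_component_ge[OF f G \<open>0 \<le> t\<close>])
    finally show "measure unif {s \<in> {0<..<1}. t \<le> \<bar>Z s\<bar>} \<le> f t" .
  qed
  with Z(2) show ?thesis using that by blast
qed

theorem theorem4p6p2:
  fixes f :: "'n::finite \<Rightarrow> real \<Rightarrow> real" and V :: "(real ^ 'n) set"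
  assumes "\<And>k. f k \<in> tail_bounds" and "closed V"
  shows "\<exists>G :: 'n \<Rightarrow> real set.
    product_set G \<in> sets borel \<and> (\<forall>k. G k \<in> sets borel) \<and> 0 \<in> product_set G \<and>
    (\<forall>k. closed (abs ` G k)) \<and>
    (SUP X\<in>tail_bounded_rvs f. \<P>(s in cube_measure. X s \<in> V)) =
      \<P>(s in cube_measure. abs_shift f G s \<in> V)"
proof -
  have rearr: "\<exists>Z. \<forall>k. tail_bounded_neat (f k) (Z k) \<and>
      distr unif borel (Z k) = distr unif borel (abs_shift_component (f k) (G k))"
    if "\<And>k. 0 \<in> G k \<and> closed (abs ` G k) \<and> G k \<in> sets borel" for G
  proof -
    have "\<exists>Z. tail_bounded_neat (f k) Z \<and>
        distr unif borel Z = distr unif borel (abs_shift_component (f k) (G k))" for k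
    proof -
      have "0 \<in> G k" "closed (abs ` G k)" "G k \<in> sets borel" using that[of k] by simp_all
      then show ?thesis by (rule tail_bounded_neat_shift_rearrangement[OF assms(1)]) blast
    qed
    then show ?thesis by (intro choice allI)
  qed
  \<comment> \<open>The shift into \<open>{0}\<close> provides an admissible choice; without one the
    supremum would be over the empty set.\<close>
  have ne: "\<exists>X. \<forall>k. tail_bounded_neat (f k) (X k)"
  proof -
    have "0 \<in> {0 :: real} \<and> closed (abs ` {0 :: real}) \<and> {0 :: real} \<in> sets borel" by simp
    from rearr[of "\<lambda>_. {0}", OF this] show ?thesis by blast
  qed
  obtain Y where Y: "\<forall>k. tail_bounded_neat (f k) (Y k)"
    and max: "\<forall>X. (\<forall>k. tail_bounded_neat (f k) (X k)) \<longrightarrow> hit_prob V X \<le> hit_prob V Y"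
    using hit_prob_attains_max[OF assms ne] by (elim exE conjE) (rule that)
  have "\<exists>G. (\<forall>k. 0 \<in> G k \<and> closed (abs ` G k) \<and> G k \<in> sets borel) \<and>
      hit_prob V Y \<le> hit_prob V (\<lambda>k. abs_shift_component (f k) (G k))"
    using Y by (intro hit_prob_le_shift assms) (simp_all add: tail_bounded_neat_def measurable_neat)
  then obtain G where G: "\<And>k. 0 \<in> G k \<and> closed (abs ` G k) \<and> G k \<in> sets borel"
    and le: "hit_prob V Y \<le> hit_prob V (\<lambda>k. abs_shift_component (f k) (G k))"
    by (elim exE conjE) (rule that, rule spec)
  obtain Z where Z: "\<And>k. tail_bounded_neat (f k) (Z k)"
    "\<And>k. distr unif borel (Z k) = distr unif borel (abs_shift_component (f k) (G k))"
    using rearr[of G, OF G] by blast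
  \<comment> \<open>Reverse inequality: \<open>Z\<close> competes with the maximiser
    \<open>Y\<close>, so the shift cannot exceed the supremum.\<close>
  have "hit_prob V (\<lambda>k. abs_shift_component (f k) (G k)) = hit_prob V Z"
  proof (rule hit_prob_cong_distr[OF assms(2)])
    show "abs_shift_component (f k) (G k) \<in> borel_measurable unif" for k
      using G[of k] by (intro measurable_abs_shift_component assms(1)) simp_all
    show "Z k \<in> borel_measurable unif" for k
      using Z(1)[of k] by (simp add: tail_bounded_neat_def measurable_neat)
  qed (simp only: Z(2))
  with le max[rule_format, OF Z(1)] have eq: "hit_prob V (\<lambda>k. abs_shift_component (f k) (G k)) = hit_prob V Y"
    by simp
  have "(SUP X\<in>tail_bounded_rvs f. \<P>(s in cube_measure. X s \<in> V))
      = (SUP X\<in>{X. \<forall>k. tail_bounded_neat (f k) (X k)}. hit_prob V X)"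
    by (simp add: tail_bounded_rvs_eq image_image hit_prob_def)
  also have "\<dots> = hit_prob V Y"
  proof (rule cSup_eq_maximum)
    show "hit_prob V Y \<in> hit_prob V ` {X. \<forall>k. tail_bounded_neat (f k) (X k)}" using Y by blast
  qed (use max in blast)
  also have "\<dots> = \<P>(s in cube_measure. abs_shift f G s \<in> V)"
    using eq by (simp add: hit_prob_def abs_shift_def)
  finally have "(SUP X\<in>tail_bounded_rvs f. \<P>(s in cube_measure. X s \<in> V))
      = \<P>(s in cube_measure. abs_shift f G s \<in> V)" .
  moreover have "product_set G \<in> sets borel"
  proof -
    have [measurable]: "G k \<in> sets borel" for k using G by simp
    show ?thesis unfolding product_set_def by measurable
  qed
  moreover have "0 \<in> product_set G" using G by (simp add: product_set_def)
  ultimately show ?thesis using G by blast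
qed

end
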